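(* Suppose the following hold. (A1) $X$ and $Y(\mathbf{x})$, for each $\mathbf{x}\in X$, are non-empty and bounded. (A2) The support of $\mathbb{Q}^*$ is known and given by the non-empty compact polyhedral set $S=\{\mathbf{c}\in\mathbb{R}^n:\mathbf{B}\mathbf{c}\le\mathbf{b}\}$. (A3) The data sets $\hat{\mathbf{C}}_l,\hat{\mathbf{C}}_f$ are i.i.d. samples from $\mathbb{Q}^*$ of sizes $k_l\ge k_f$, with $\hat{\mathbf{c}}_f^{(k)}=\hat{\mathbf{c}}_l^{(k)}$ for each $k\in\{1,\dots,k_f\}$. (A4) For given sample sizes $k_l,k_f$ and significance levels $\theta_{k_l},\theta_{k_f}\in(0,1)$, the Wasserstein radii $\varepsilon_l=\varepsilon_l(\theta_{k_l})$ and $\varepsilon_f=\varepsilon_f(\theta_{k_f})$ can be (and are) selected so that $\mathbb{Q}^*$ belongs to $\mathcal{Q}_l$ and $\mathcal{Q}_f$, respectively, with probabilities of at least $1-\theta_{k_l}$ and $1-\theta_{k_f}$; moreover, $\sum_{k_i=1}^\infty\theta_{k_i}<\infty$ and $\lim_{k_i\to\infty}\varepsilon_i(\theta_{k_i})=0$ for each $i\in\{l,f\}$. (A5) For every fixed $\mathbf{x}\in X$, the problem $\max_{\bar{\mathbf{y}}\in\bar Y(\mathbf{x})}\mathbb{E}_{\mathbb{Q}^*}\{h_f(\bar{\mathbf{y}},\mathbf{c})\}$ has a unique optimal solution. Let $$\hat z_l^*(\hat{\mathbf{C}}_l,\hat{\mathbf{C}}_f):=\min_{\bar{\mathbf{x}}\in\bar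 X(\hat{\mathbf{C}}_f)}\ \max_{\mathbb{Q}_l\in\mathcal{Q}_l}\mathbb{E}_{\mathbb{Q}_l}\{h_l(\bar{\mathbf{x}},\mathbf{c})\}.$$ Then, $\mathbb{Q}^{*\infty}$-almost surely, $$\limsup_{k_f\to\infty}\ \limsup_{k_l\to\infty}\ \hat z_l^*(\hat{\mathbf{C}}_l,\hat{\mathbf{C}}_f)=z^*:=\min_{\bar{\mathbf{x}}\in\bar X^*}\mathbb{E}_{\mathbb{Q}^*}\{h_l(\bar{\mathbf{x}},\mathbf{c})\},$$ where $z^*$ is the optimal objective function value of the stochastic programming problem $[\mathbf{SI}]$: $\min_{\mathbf{x},\mathbf{y}}\rho_l(\mathbf{y},\mathbb{Q}^* )$ s.t. $\mathbf{x}\in X$, $\mathbf{y}\in\arg\max_{\tilde{\mathbf{y}}\in Y(\mathbf{x})}\rho_f(\tilde{\mathbf{y}},\mathbb{Q}^* )$. Furthermore, if $\bar{\mathbf{x}}^*(k_l,k_f)$ is an optimal solution of the problem defining $\hat z_l^*(\hat{\mathbf{C}}_l,\hat{\mathbf{C}}_f)$, then $\mathbb{Q}^{*\infty}$-almost surely any resulting accumulation point of $\{\bar{\mathbf{x}}^*(k_l,k_f)\}_{k_l,k_f\in\mathbb{N}}$ is an optimal solution of the full information problem $\min_{\bar{\mathbf{x}}\in\bar X^*}\mathbb{E}_{\mathbb{Q}^*}\{h_l(\bar{\mathbf{x}},\mathbf{c})\}$.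
   Context: Feasible sets: $X=\{\mathbf{x}\in\{0,1\}^m:\mathbf{H}\mathbf{x}\le\mathbf{h}\}$ and $Y(\mathbf{x})=\{\mathbf{y}\in\mathbb{R}^n_+:\mathbf{F}\mathbf{y}+\mathbf{L}\mathbf{x}\le\mathbf{f}\}$. $\mathcal{Q}_0(S)$ is the set of all probability distributions on $S$; $\mathbb{Q}^*\in\mathcal{Q}_0(S)$ is the true distribution of the random vector $\mathbf{c}$; $\mathbb{Q}^{*\infty}$ is the law of an infinite i.i.d. sample from $\mathbb{Q}^*$. Data $\hat{\mathbf{C}}_i=\{\hat{\mathbf{c}}_i^{(k)}\in S:k\in K_i=\{1,\dots,k_i\}\}$, $i\in\{l,f\}$ ($l$: leader, $f$: follower); empirical distribution $\hat{\mathbb{Q}}_i=\frac1{k_i}\sum_{k\in K_i}\delta(\hat{\mathbf{c}}_i^{(k)})$, with $\delta(\cdot)$ the Dirac measure; ambiguity set $\mathcal{Q}_i=\{\mathbb{Q}\in\mathcal{Q}_0(S):W^p(\hat{\mathbb{Q}}_i,\mathbb{Q})\le\varepsilon_i\}$, where $\varepsilon_i\in\mathbb{R}_+$ and $W^p$ is the type-1 Wasserstein distance with the $\ell_p$-norm as ground metric, $p\in\{1,\infty\}$. Confidence levels $\alpha_l,\alpha_f\in(0,1)$; $a^+=\max\{a,0\}$, $a^-=\min\{a,0\}$; $\rho_l(\mathbf{y},\mathbb{Q})=\min_{t\in\mathbb{R}}\{t+\frac1{1-\alpha_l}\mathbb{E}_{\mathbb{Q}}[(\mathbf{c}^\top\mathbf{y}-t)^+]\}$,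 $\rho_f(\mathbf{y},\mathbb{Q})=\max_{t\in\mathbb{R}}\{t+\frac1{1-\alpha_f}\mathbb{E}_{\mathbb{Q}}[(\mathbf{c}^\top\mathbf{y}-t)^-]\}$. Notation: $\underline t_l=\underline t_f:=\min_{\mathbf{x}\in X}\min_{(\mathbf{c},\mathbf{y})\in S\times Y(\mathbf{x})}\mathbf{c}^\top\mathbf{y}$ and $\overline t_l=\overline t_f:=\max_{\mathbf{x}\in X}\max_{(\mathbf{c},\mathbf{y})\in S\times Y(\mathbf{x})}\mathbf{c}^\top\mathbf{y}$. $\bar{\mathbf{y}}=(\mathbf{y},t_f)$, $\bar Y(\mathbf{x})=Y(\mathbf{x})\times[\underline t_f,\overline t_f]$, $h_f(\bar{\mathbf{y}},\mathbf{c})=t_f+\frac1{1-\alpha_f}(\mathbf{c}^\top\mathbf{y}-t_f)^-$. $\bar{\mathbf{x}}=(\mathbf{x},\bar{\mathbf{y}},t_l)$, $h_l(\bar{\mathbf{x}},\mathbf{c})=t_l+\frac1{1-\alpha_l}(\mathbf{c}^\top\mathbf{y}-t_l)^+$. $\hat V_f(\mathbf{x},\hat{\mathbf{C}}_f)=\arg\max_{\bar{\mathbf{y}}\in\bar Y(\mathbf{x})}\{\min_{\mathbb{Q}_f\in\mathcal{Q}_f}\mathbb{E}_{\mathbb{Q}_f}[h_f(\bar{\mathbf{y}},\mathbf{c})]\}$ and $\bar X(\hat{\mathbf{C}}_f)=\{(\mathbf{x},\bar{\mathbf{y}},t_l):\mathbf{x}\in X,\ \bar{\mathbf{y}}\in\hat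 V_f(\mathbf{x},\hat{\mathbf{C}}_f),\ t_l\in[\underline t_l,\overline t_l]\}$. $V_f^*(\mathbf{x})=\arg\max_{\bar{\mathbf{y}}\in\bar Y(\mathbf{x})}\mathbb{E}_{\mathbb{Q}^*}[h_f(\bar{\mathbf{y}},\mathbf{c})]$ and $\bar X^*=\{(\mathbf{x},\bar{\mathbf{y}},t_l):\mathbf{x}\in X,\ \bar{\mathbf{y}}\in V_f^*(\mathbf{x}),\ t_l\in[\underline t_l,\overline t_l]\}$. *)

theory Defs
  imports "HOL-Probability.Probability"
begin

section \<open>Feasible sets\<close>

text \<open>The order on vectors is the componentwise one.\<close>

definition leader_feasible :: "real^'m^'r \<Rightarrow> real^'r \<Rightarrow> (real^'m) set" where
  "leader_feasible H h = {x. (\<forall>i. x $ i \<in> {0, 1}) \<and> H *v x \<le> h}"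

definition follower_feasible ::
    "real^'n^'q \<Rightarrow> real^'m^'q \<Rightarrow> real^'q \<Rightarrow> real^'m \<Rightarrow> (real^'n) set" where
  "follower_feasible F L f x = {y. 0 \<le> y \<and> F *v y + L *v x \<le> f}"

definition polyhedral_set :: "real^'n^'s \<Rightarrow> real^'s \<Rightarrow> (real^'n) set" where
  "polyhedral_set B b = {c. B *v c \<le> b}"


section \<open>Distributions, Wasserstein distance and ambiguity sets\<close>

definition distributions_on :: "(real^'n) set \<Rightarrow> (real^'n) measure set" where
  "distributions_on S = {Q. sets Q = sets borel \<and> prob_space Q \<and> emeasure Q S = 1}"

definition measure_support :: "(real^'n) measure \<Rightarrow> (real^'n) set" where
  "measure_support Q = {c. \<forall>U. open U \<longrightarrow> c \<in> U \<longrightarrow> 0 < emeasure Q U}"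

definition lp_norm :: "ereal \<Rightarrow> real^'n \<Rightarrow> real" where
  "lp_norm p x =
     (if p = \<infinity> then infnorm x
      else (\<Sum>i\<in>UNIV. \<bar>x $ i\<bar> powr real_of_ereal p) powr (1 / real_of_ereal p))"

lemma lp_norm_1: "lp_norm 1 x = (\<Sum>i\<in>UNIV. \<bar>x $ i\<bar>)"
  by (simp add: lp_norm_def one_ereal_def sum_nonneg)

definition couplings ::
    "(real^'n) measure \<Rightarrow> (real^'n) measure \<Rightarrow> ((real^'n) \<times> (real^'n)) measure set" where
  "couplings Q1 Q2 =
     {\<pi>. sets \<pi> = sets (borel \<Otimes>\<^sub>M borel) \<and> distr \<pi> borel fst = Q1 \<and> distr \<pi> borel snd = Q2}"

text \<open>Type-1 Wasserstein distance with the \<open>\<ell>\<^sub>p\<close>-norm as ground metric; the value is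
  \<open>\<infinity>\<close> if there is no coupling with finite transportation cost.\<close>

definition wasserstein ::
    "ereal \<Rightarrow> (real^'n) measure \<Rightarrow> (real^'n) measure \<Rightarrow> ennreal" where
  "wasserstein p Q1 Q2 =
     (INF \<pi>\<in>couplings Q1 Q2. \<integral>\<^sup>+ z. ennreal (lp_norm p (fst z - snd z)) \<partial>\<pi>)"

text \<open>A realisation of the infinite i.i.d. sample is a sequence \<open>\<omega>\<close>; a data set of size \<open>k\<close>
  consists of its first \<open>k\<close> entries \<open>\<omega> 0, \<dots>, \<omega> (k - 1)\<close>. Hence the smaller
  of two data sets is always an initial segment of the larger one. Only sizes \<open>k \<ge> 1\<close> are
  meaningful.\<close>

definition empirical :: "(nat \<Rightarrow> real^'n) \<Rightarrow> nat \<Rightarrow> (real^'n) measure" where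
  "empirical \<omega> k =
     measure_of UNIV (sets borel) (\<lambda>A. (\<Sum>j<k. emeasure (return borel (\<omega> j)) A) / of_nat k)"

lemma sets_empirical [simp]: "sets (empirical \<omega> k) = sets borel"
  unfolding empirical_def using sets.sets_measure_of_eq[of borel] by simp

lemma emeasure_empirical:
  fixes \<omega> :: "nat \<Rightarrow> real^'n"
  assumes "A \<in> sets borel"
  shows "emeasure (empirical \<omega> k) A = (\<Sum>j<k. emeasure (return borel (\<omega> j)) A) / of_nat k"
proof (rule emeasure_measure_of[OF empirical_def])
  show "sets (borel :: (real^'n) measure) \<subseteq> Pow UNIV" by simp
  show "A \<in> sets (empirical \<omega> k)" using assms by simp
  show "positive (sets (empirical \<omega> k)) (\<lambda>A. (\<Sum>j<k. emeasure (return borel (\<omega> j)) A) / of_nat k)"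
    by (simp add: positive_def)
  show "countably_additive (sets (empirical \<omega> k))
          (\<lambda>A. (\<Sum>j<k. emeasure (return borel (\<omega> j)) A) / of_nat k)"
  proof (rule countably_additiveI)
    fix E :: "nat \<Rightarrow> (real^'n) set"
    assume E: "range E \<subseteq> sets (empirical \<omega> k)" "disjoint_family E"
    have "(\<Sum>i. emeasure (return borel (\<omega> j)) (E i)) = emeasure (return borel (\<omega> j)) (\<Union> (range E))" for j
      using E by (intro suminf_emeasure) auto
    then show "(\<Sum>i. (\<Sum>j<k. emeasure (return borel (\<omega> j)) (E i)) / of_nat k)
        = (\<Sum>j<k. emeasure (return borel (\<omega> j)) (\<Union> (range E))) / of_nat k"
      by (simp add: divide_ennreal_def suminf_sum)
  qed
qed

lemma prob_space_empirical:
  fixes \<omega> :: "nat \<Rightarrow> real^'n"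
  assumes "k \<ge> 1"
  shows "prob_space (empirical \<omega> k)"
proof (rule prob_spaceI)
  have "space (empirical \<omega> k) = UNIV"
    using sets_eq_imp_space_eq[OF sets_empirical] by simp
  moreover have "(of_nat k :: ennreal) / of_nat k = 1"
    using assms by (intro ennreal_divide_self) (auto simp: of_nat_less_top)
  ultimately show "emeasure (empirical \<omega> k) (space (empirical \<omega> k)) = 1"
    by (simp add: emeasure_empirical)
qed

definition ambiguity_set ::
    "(real^'n) set \<Rightarrow> ereal \<Rightarrow> (nat \<Rightarrow> real^'n) \<Rightarrow> nat \<Rightarrow> real \<Rightarrow> (real^'n) measure set" where
  "ambiguity_set S p \<omega> k \<epsilon> =
     {Q \<in> distributions_on S. wasserstein p (empirical \<omega> k) Q \<le> ennreal \<epsilon>}"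


section \<open>Risk measures and the stochastic programming problem\<close>

text \<open>Optimal values are infima and suprema in the extended reals, so that no junk value can
  arise from an empty or unbounded problem.\<close>

definition \<rho>\<^sub>l :: "real \<Rightarrow> real^'n \<Rightarrow> (real^'n) measure \<Rightarrow> ereal" where
  "\<rho>\<^sub>l \<alpha> y Q = (INF t::real. ereal (t + 1 / (1 - \<alpha>) * (\<integral>c. max (c \<bullet> y - t) 0 \<partial>Q)))"

definition \<rho>\<^sub>f :: "real \<Rightarrow> real^'n \<Rightarrow> (real^'n) measure \<Rightarrow> ereal" where
  "\<rho>\<^sub>f \<alpha> y Q = (SUP t::real. ereal (t + 1 / (1 - \<alpha>) * (\<integral>c. min (c \<bullet> y - t) 0 \<partial>Q)))"

definition SI_feasible ::
    "real \<Rightarrow> (real^'m) set \<Rightarrow> (real^'m \<Rightarrow> (real^'n) set) \<Rightarrow> (real^'n) measure \<Rightarrow> ((real^'m) \<times> (real^'n)) set"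
  where
  "SI_feasible \<alpha>f X Y Q =
     {(x, y). x \<in> X \<and> is_arg_max (\<lambda>y'. \<rho>\<^sub>f \<alpha>f y' Q) (\<lambda>y'. y' \<in> Y x) y}"

definition SI_value ::
    "real \<Rightarrow> real \<Rightarrow> (real^'m) set \<Rightarrow> (real^'m \<Rightarrow> (real^'n) set) \<Rightarrow> (real^'n) measure \<Rightarrow> ereal" where
  "SI_value \<alpha>l \<alpha>f X Y Q = (INF (x, y)\<in>SI_feasible \<alpha>f X Y Q. \<rho>\<^sub>l \<alpha>l y Q)"


section \<open>Extended formulation\<close>

text \<open>An extended follower decision is \<open>(y, t\<^sub>f)\<close>, an extended leader decision
  \<open>(x, (y, t\<^sub>f), t\<^sub>l)\<close>.\<close>

type_synonym 'n follower_var = "(real^'n) \<times> real"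
type_synonym ('m, 'n) leader_var = "(real^'m) \<times> 'n follower_var \<times> real"

definition h\<^sub>f :: "real \<Rightarrow> 'n::finite follower_var \<Rightarrow> real^'n \<Rightarrow> real" where
  "h\<^sub>f \<alpha> = (\<lambda>(y, tf) c. tf + 1 / (1 - \<alpha>) * min (c \<bullet> y - tf) 0)"

definition h\<^sub>l :: "real \<Rightarrow> ('m::finite, 'n::finite) leader_var \<Rightarrow> real^'n \<Rightarrow> real" where
  "h\<^sub>l \<alpha> = (\<lambda>(x, (y, tf), tl) c. tl + 1 / (1 - \<alpha>) * max (c \<bullet> y - tl) 0)"

definition t_range ::
    "(real^'m) set \<Rightarrow> (real^'m \<Rightarrow> (real^'n) set) \<Rightarrow> (real^'n) set \<Rightarrow> real set" where
  "t_range X Y S =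
     {(INF x\<in>X. INF (c, y)\<in>S \<times> Y x. c \<bullet> y) .. (SUP x\<in>X. SUP (c, y)\<in>S \<times> Y x. c \<bullet> y)}"

definition robust_follower_solutions ::
    "real \<Rightarrow> 'n::finite follower_var set \<Rightarrow> (real^'n) measure set \<Rightarrow> 'n follower_var set" where
  "robust_follower_solutions \<alpha> Ybar \<Q> =
     {ybar. is_arg_max (\<lambda>yb. INF Q\<in>\<Q>. ereal (\<integral>c. h\<^sub>f \<alpha> yb c \<partial>Q)) (\<lambda>yb. yb \<in> Ybar) ybar}"

definition nominal_follower_solutions ::
    "real \<Rightarrow> 'n::finite follower_var set \<Rightarrow> (real^'n) measure \<Rightarrow> 'n follower_var set" where
  "nominal_follower_solutions \<alpha> Ybar Q =
     {ybar. is_arg_max (\<lambda>yb. \<integral>c. h\<^sub>f \<alpha> yb c \<partial>Q) (\<lambda>yb. yb \<in> Ybar) ybar}"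

definition extended_leader_set ::
    "(real^'m) set \<Rightarrow> (real^'m \<Rightarrow> 'n::finite follower_var set) \<Rightarrow> real set
       \<Rightarrow> ('m::finite, 'n) leader_var set" where
  "extended_leader_set X V T = {(x, ybar, tl). x \<in> X \<and> ybar \<in> V x \<and> tl \<in> T}"

definition worst_case_leader_cost ::
    "real \<Rightarrow> (real^'n) measure set \<Rightarrow> ('m::finite, 'n::finite) leader_var \<Rightarrow> ereal" where
  "worst_case_leader_cost \<alpha> \<Q> xbar = (SUP Q\<in>\<Q>. ereal (\<integral>c. h\<^sub>l \<alpha> xbar c \<partial>Q))"

text \<open>Accumulation points of a doubly indexed family as both sample sizes \<open>kl \<ge> kf\<close> tend to
  infinity (cluster points of the net). For constant \<open>kf\<close> the data of the follower would
  stay a fixed finite sample.\<close>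

definition accumulation_point ::
    "(nat \<Rightarrow> nat \<Rightarrow> 'a::topological_space) \<Rightarrow> 'a \<Rightarrow> bool" where
  "accumulation_point u z \<longleftrightarrow>
     (\<forall>U. open U \<longrightarrow> z \<in> U \<longrightarrow> (\<forall>N. \<exists>kl kf. N \<le> kf \<and> kf \<le> kl \<and> u kl kf \<in> U))"

end

theory Submission
  imports Defs
begin

text \<open>By the Borel-Cantelli lemma the true distribution almost surely lies in both ambiguity sets from
  some sample size on. Two distributions in an ambiguity set of radius \<open>\<epsilon>\<close> give expectations of a
  \<open>K\<close>-Lipschitz cost that differ by at most \<open>2 * K * \<epsilon>\<close>, so both robust objectives converge to the
  nominal ones uniformly on the bounded feasible sets. A robust follower solution is therefore nearly
  optimal for the nominal problem, and since the nominal solution is unique, compactness forces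
  it to be close to that solution, uniformly over the finitely many leader decisions. The cost of the
  leader is Lipschitz in the follower decision, which gives the limits. For the identity with \<open>[SI]\<close>,
  the variables \<open>t\<close> in both conditional values at risk can be restricted to the range of the cost.\<close>

section \<open>Stability of bilevel problems\<close>

text \<open>Outside the ball of radius \<open>\<eta>\<close> the function attains a maximum by
  compactness, and uniqueness puts it strictly below \<open>g x0\<close>; half of the gap serves as
  \<open>\<delta>\<close>. This turns near-optimality into closeness to the optimum.\<close>

lemma well_separated_maximum:
  fixes g :: "'a::metric_space \<Rightarrow> real"
  assumes "compact K" "continuous_on K g" "0 < \<eta>"
    and unique: "\<And>x. x \<in> K \<Longrightarrow> g x0 \<le> g x \<Longrightarrow> x = x0"
  obtains \<delta> where "0 < \<delta>" "\<And>x. x \<in> K \<Longrightarrow> g x0 - \<delta> \<le> g x \<Longrightarrow> dist x x0 < \<eta>"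
proof (cases "K - ball x0 \<eta> = {}")
  case True
  then show ?thesis
    by (intro that[of 1]) (auto simp: dist_commute)
next
  case False
  have "compact (K - ball x0 \<eta>)" "continuous_on (K - ball x0 \<eta>) g"
    using assms by (auto intro: compact_diff continuous_on_subset)
  from continuous_attains_sup[OF this(1) False this(2)]
  obtain m where m: "m \<in> K" "m \<notin> ball x0 \<eta>" "\<And>x. x \<in> K - ball x0 \<eta> \<Longrightarrow> g x \<le> g m"
    by auto
  have "g m < g x0"
    using unique[of m] m \<open>0 < \<eta>\<close> by force
  show ?thesis
  proof (rule that[of "(g x0 - g m) / 2"])
    show "0 < (g x0 - g m) / 2"
      using \<open>g m < g x0\<close> by simp
    fix x assume "x \<in> K" "g x0 - (g x0 - g m) / 2 \<le> g x"
    then have "g m < g x"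
      using \<open>g m < g x0\<close> by (simp add: field_simps)
    then show "dist x x0 < \<eta>"
      using m(3)[of x] \<open>x \<in> K\<close> by (fastforce simp: dist_commute)
  qed
qed

lemma extended_leader_set_iff:
  "(x, yb, t) \<in> extended_leader_set X V T \<longleftrightarrow> x \<in> X \<and> yb \<in> V x \<and> t \<in> T"
  by (simp add: extended_leader_set_def)

text \<open>The set-valued maps \<open>V k\<close> shrink to the single-valued map \<open>ys\<close> and the costs \<open>wc k\<close> tend
  to \<open>\<psi>\<close> from above. Both limits are uniform, so every bound below holds for all large \<open>kf\<close> and \<open>kl\<close>
  independently of each other; the order of the two limits is therefore irrelevant.\<close>

lemma bilevel_convergence:
  fixes V :: "nat \<Rightarrow> real^'m \<Rightarrow> 'n::finite follower_var set"
    and wc :: "nat \<Rightarrow> ('m::finite, 'n) leader_var \<Rightarrow> ereal"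
    and \<psi> :: "('m, 'n) leader_var \<Rightarrow> real"
    and X :: "(real^'m) set" and ys :: "real^'m \<Rightarrow> 'n follower_var" and T :: "real set"
  defines "Xs \<equiv> extended_leader_set X (\<lambda>x. {ys x}) T"
    and "Xh \<equiv> \<lambda>k. extended_leader_set X (V k) T"
  assumes "finite X" "closed T"
    and V_ne: "\<forall>\<^sub>F k in sequentially. \<forall>x\<in>X. V k x \<noteq> {}"
    and V_lim: "\<And>\<eta>. 0 < \<eta> \<Longrightarrow> \<forall>\<^sub>F k in sequentially. \<forall>x\<in>X. \<forall>yb\<in>V k x. dist yb (ys x) < \<eta>"
    and V_sub: "\<And>k. Xh k \<subseteq> D"
    and wc_ge: "\<forall>\<^sub>F k in sequentially. \<forall>w\<in>D. ereal (\<psi> w) \<le> wc k w"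
    and wc_le: "\<And>\<eta>. 0 < \<eta> \<Longrightarrow> \<forall>\<^sub>F k in sequentially. \<forall>w\<in>D. wc k w \<le> ereal (\<psi> w + \<eta>)"
    and \<psi>: "\<And>w w'. \<bar>\<psi> w - \<psi> w'\<bar> \<le> C * dist (snd w) (snd w')"
  shows "limsup (\<lambda>kf. limsup (\<lambda>kl. INF w\<in>Xh kf. wc kl w)) = (INF w\<in>Xs. ereal (\<psi> w))" (is ?lim)
    and "\<lbrakk>\<And>kl kf. 1 \<le> kf \<Longrightarrow> kf \<le> kl \<Longrightarrow> is_arg_min (wc kl) (\<lambda>w. w \<in> Xh kf) (u kl kf);
      accumulation_point u z\<rbrakk> \<Longrightarrow> is_arg_min \<psi> (\<lambda>w. w \<in> Xs) z" (is "\<lbrakk>PROP ?u; ?z\<rbrakk> \<Longrightarrow> ?acc")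
proof -
  \<comment> \<open>The sign of \<open>C\<close> is unknown; \<open>K\<close> is a Lipschitz
    constant that is surely positive, so that division by \<open>2 * K\<close> is possible.\<close>
  define K where "K = \<bar>C\<bar> + 1"
  have K: "0 < K" "\<bar>\<psi> w - \<psi> w'\<bar> \<le> K * dist (snd w) (snd w')" for w w'
  proof -
    have "C * dist (snd w) (snd w') \<le> K * dist (snd w) (snd w')"
      by (intro mult_right_mono) (auto simp: K_def)
    then show "\<bar>\<psi> w - \<psi> w'\<bar> \<le> K * dist (snd w) (snd w')"
      using \<psi>[of w w'] by linarith
  qed (auto simp: K_def)
  \<comment> \<open>The Lipschitz bound sees only the second component of a leader decision, so with
    equal \<open>t\<close> only the follower decisions have to be compared.\<close>
  have near: "\<psi> (x, yb, t) \<le> \<psi> (x', yb', t) + \<eta> / 2" if "dist yb yb' < \<eta> / (2 * K)" for x x' yb yb' t \<eta>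
  proof -
    have "dist (yb, t) (yb', t) = dist yb yb'"
      by (simp add: dist_prod_def)
    then have "\<bar>\<psi> (x, yb, t) - \<psi> (x', yb', t)\<bar> \<le> K * dist yb yb'"
      using K(2)[of "(x, yb, t)" "(x', yb', t)"] by simp
    also have "\<dots> \<le> K * (\<eta> / (2 * K))"
      using that K(1) by (intro mult_left_mono) auto
    also have "\<dots> = \<eta> / 2"
      using K(1) by simp
    finally show ?thesis by linarith
  qed
  \<comment> \<open>One threshold serves both directions: each point of \<open>Xs\<close> is matched
    by a point of \<open>Xh kf\<close> whose robust cost is larger by at most \<open>\<eta>\<close>,
    and conversely.\<close>
  have key: "\<exists>N. \<forall>kf\<ge>N. (\<forall>x\<in>X. \<forall>yb\<in>V kf x. dist yb (ys x) < \<eta>) \<and>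
     (\<forall>kl\<ge>N. (\<forall>w\<in>Xs. \<exists>w'\<in>Xh kf. wc kl w' \<le> ereal (\<psi> w + \<eta>)) \<and>
       (\<forall>w'\<in>Xh kf. ereal (\<psi> w') \<le> wc kl w' \<and> (\<exists>w\<in>Xs. ereal (\<psi> w) \<le> wc kl w' + ereal \<eta>)))"
    if "0 < \<eta>" for \<eta>
  proof -
    \<comment> \<open>The bound \<open>\<eta> / (2 * K)\<close> makes an exchange of follower
      decisions cost at most \<open>\<eta> / 2\<close>; the other half of \<open>\<eta>\<close> is
      spent on \<open>wc_le\<close>.\<close>
    define d where "d = min \<eta> (\<eta> / (2 * K))"
    have "0 < d" using that K(1) by (simp add: d_def)
    have "\<forall>\<^sub>F k in sequentially. (\<forall>x\<in>X. V k x \<noteq> {}) \<and> (\<forall>x\<in>X. \<forall>yb\<in>V k x. dist yb (ys x) < d) \<and>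
        (\<forall>w\<in>D. ereal (\<psi> w) \<le> wc k w) \<and> (\<forall>w\<in>D. wc k w \<le> ereal (\<psi> w + \<eta> / 2))"
      using V_ne V_lim[OF \<open>0 < d\<close>] wc_ge wc_le[of "\<eta> / 2"] that by (intro eventually_conj) auto
    then obtain N where N: "\<And>k. k \<ge> N \<Longrightarrow> (\<forall>x\<in>X. V k x \<noteq> {}) \<and> (\<forall>x\<in>X. \<forall>yb\<in>V k x. dist yb (ys x) < d) \<and>
        (\<forall>w\<in>D. ereal (\<psi> w) \<le> wc k w) \<and> (\<forall>w\<in>D. wc k w \<le> ereal (\<psi> w + \<eta> / 2))"
      by (auto simp: eventually_sequentially)
    show ?thesis
    proof (intro exI[of _ N] allI impI conjI ballI)
      fix kf assume kf: "N \<le> kf"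
      show "dist yb (ys x) < \<eta>" if "x \<in> X" "yb \<in> V kf x" for x yb
        using N[OF kf] that by (force simp: d_def)
      fix kl assume kl: "N \<le> kl"
      show "\<exists>w'\<in>Xh kf. wc kl w' \<le> ereal (\<psi> w + \<eta>)" if w: "w \<in> Xs" for w
      proof -
        obtain x t where w_eq: "w = (x, ys x, t)" and x: "x \<in> X" "t \<in> T"
          using w by (cases w) (auto simp: Xs_def extended_leader_set_def)
        obtain yb where yb: "yb \<in> V kf x"
          using N[OF kf] x by blast
        have in_Xh: "(x, yb, t) \<in> Xh kf"
          using x yb by (simp add: Xh_def extended_leader_set_iff)
        have "dist yb (ys x) < \<eta> / (2 * K)"
          using N[OF kf] x yb by (force simp: d_def)
        then have "\<psi> (x, yb, t) + \<eta> / 2 \<le> \<psi> w + \<eta>"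
          using near[where x = x and x' = x and t = t] by (fastforce simp: w_eq)
        moreover have "wc kl (x, yb, t) \<le> ereal (\<psi> (x, yb, t) + \<eta> / 2)"
          using N[OF kl] in_Xh V_sub by blast
        ultimately have "wc kl (x, yb, t) \<le> ereal (\<psi> w + \<eta>)"
          by (meson ereal_less_eq(3) order_trans)
        then show ?thesis using in_Xh by blast
      qed
      fix w' assume w': "w' \<in> Xh kf"
      then show le: "ereal (\<psi> w') \<le> wc kl w'"
        using N[OF kl] V_sub by blast
      obtain x yb t where w'_eq: "w' = (x, yb, t)" and x: "x \<in> X" "t \<in> T" "yb \<in> V kf x"
        using w' by (cases w') (auto simp: Xh_def extended_leader_set_def)
      have "dist (ys x) yb < \<eta> / (2 * K)"
        using N[OF kf] x by (force simp: d_def dist_commute)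
      then have "\<psi> (x, ys x, t) \<le> \<psi> w' + \<eta>"
        using near[where x = x and x' = x and t = t] that by (fastforce simp: w'_eq)
      then have "ereal (\<psi> (x, ys x, t)) \<le> ereal (\<psi> w') + ereal \<eta>"
        by simp
      also have "\<dots> \<le> wc kl w' + ereal \<eta>"
        using le by (intro add_right_mono)
      finally show "\<exists>w\<in>Xs. ereal (\<psi> w) \<le> wc kl w' + ereal \<eta>"
        using x by (intro bexI[of _ "(x, ys x, t)"]) (auto simp: Xs_def extended_leader_set_iff)
    qed
  qed

  \<comment> \<open>Convergence of the optimal values\<close>
  show ?lim
  proof (rule antisym)
    let ?z = "INF w\<in>Xs. ereal (\<psi> w)"
    have bounds: "\<exists>N. \<forall>kf\<ge>N. \<forall>kl\<ge>N. (INF w\<in>Xh kf. wc kl w) \<le> ?z + ereal \<eta> \<and> ?z - ereal \<eta> \<le> (INF w\<in>Xh kf. wc kl w)"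
      if \<eta>: "0 < \<eta>" for \<eta>
    proof -
      obtain N where N: "\<And>kf kl. N \<le> kf \<Longrightarrow> N \<le> kl \<Longrightarrow> (\<forall>w\<in>Xs. \<exists>w'\<in>Xh kf. wc kl w' \<le> ereal (\<psi> w + \<eta>)) \<and>
          (\<forall>w'\<in>Xh kf. \<exists>w\<in>Xs. ereal (\<psi> w) \<le> wc kl w' + ereal \<eta>)"
        using key[OF \<eta>] by blast
      show ?thesis
      proof (intro exI[of _ N] allI impI conjI)
        fix kf kl assume k: "N \<le> kf" "N \<le> kl"
        \<comment> \<open>With the constant moved to the left, the right-hand side is a bare infimum
          and can be treated point by point.\<close>
        have "(INF w\<in>Xh kf. wc kl w) - ereal \<eta> \<le> ?z"
        proof (rule INF_greatest)
          fix w assume "w \<in> Xs"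
          then obtain w' where "w' \<in> Xh kf" "wc kl w' \<le> ereal (\<psi> w + \<eta>)"
            using N[OF k] by blast
          then have "(INF w\<in>Xh kf. wc kl w) \<le> ereal (\<psi> w) + ereal \<eta>"
            by (auto intro: INF_lower2)
          then show "(INF w\<in>Xh kf. wc kl w) - ereal \<eta> \<le> ereal (\<psi> w)"
            by (simp add: ereal_minus_le_iff)
        qed
        then show "(INF w\<in>Xh kf. wc kl w) \<le> ?z + ereal \<eta>"
          by (simp add: ereal_minus_le_iff)
        show "?z - ereal \<eta> \<le> (INF w\<in>Xh kf. wc kl w)"
        proof (rule INF_greatest)
          fix w' assume "w' \<in> Xh kf"
          then obtain w where "w \<in> Xs" "ereal (\<psi> w) \<le> wc kl w' + ereal \<eta>"
            using N[OF k] by blast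
          then show "?z - ereal \<eta> \<le> wc kl w'"
            by (auto simp: ereal_minus_le_iff intro: INF_lower2)
        qed
      qed
    qed
    show "limsup (\<lambda>kf. limsup (\<lambda>kl. INF w\<in>Xh kf. wc kl w)) \<le> ?z"
    proof (rule ereal_le_epsilon2)
      fix \<eta> :: real assume "0 < \<eta>"
      then obtain N where N: "\<And>kf kl. N \<le> kf \<Longrightarrow> N \<le> kl \<Longrightarrow> (INF w\<in>Xh kf. wc kl w) \<le> ?z + ereal \<eta>"
        using bounds by blast
      show "limsup (\<lambda>kf. limsup (\<lambda>kl. INF w\<in>Xh kf. wc kl w)) \<le> ?z + ereal \<eta>"
        using N by (intro Limsup_bounded eventually_sequentiallyI[of N]) 
    qed
    show "?z \<le> limsup (\<lambda>kf. limsup (\<lambda>kl. INF w\<in>Xh kf. wc kl w))"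
    proof (rule ereal_le_epsilon2)
      fix \<eta> :: real assume "0 < \<eta>"
      then obtain N where N: "\<And>kf kl. N \<le> kf \<Longrightarrow> N \<le> kl \<Longrightarrow> ?z - ereal \<eta> \<le> (INF w\<in>Xh kf. wc kl w)"
        using bounds by blast
      have "?z - ereal \<eta> \<le> limsup (\<lambda>kf. limsup (\<lambda>kl. INF w\<in>Xh kf. wc kl w))"
        using N by (intro le_Limsup eventually_sequentiallyI[of N]) auto
      then show "?z \<le> limsup (\<lambda>kf. limsup (\<lambda>kl. INF w\<in>Xh kf. wc kl w)) + ereal \<eta>"
        by (simp add: ereal_minus_le_iff)
    qed
  qed

  \<comment> \<open>Optimality of accumulation points\<close>
  show ?acc if u: "PROP ?u" and z: ?z
  proof -
    \<comment> \<open>At every scale \<open>\<eta>\<close> some robust solution near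
      \<open>z\<close> is nearly feasible and nearly optimal for the limit problem. The scales
      \<open>1 / (n + 1)\<close> then give a sequence \<open>W\<close> converging to
      \<open>z\<close>.\<close>
    have "\<exists>w. dist w z < \<eta> \<and> fst w \<in> X \<and> snd (snd w) \<in> T \<and> dist (fst (snd w)) (ys (fst w)) < \<eta> \<and>
        (\<forall>v\<in>Xs. \<psi> w \<le> \<psi> v + \<eta>)" if \<eta>: "0 < \<eta>" for \<eta>
    proof -
      obtain N where N: "\<And>kf kl. N \<le> kf \<Longrightarrow> N \<le> kl \<Longrightarrow> (\<forall>x\<in>X. \<forall>yb\<in>V kf x. dist yb (ys x) < \<eta>) \<and>
          (\<forall>w\<in>Xs. \<exists>w'\<in>Xh kf. wc kl w' \<le> ereal (\<psi> w + \<eta>)) \<and>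
          (\<forall>w'\<in>Xh kf. ereal (\<psi> w') \<le> wc kl w')"
        using key[OF \<eta>] by blast
      \<comment> \<open>The maximum with \<open>1\<close> is taken because \<open>u kl kf\<close> is
        known to be optimal only for \<open>kf \<ge> 1\<close>.\<close>
      obtain kl kf where k: "max 1 N \<le> kf" "kf \<le> kl" "u kl kf \<in> ball z \<eta>"
        using z \<eta> unfolding accumulation_point_def by (metis centre_in_ball open_ball)
      let ?w = "u kl kf"
      have w: "?w \<in> Xh kf" "\<And>w'. w' \<in> Xh kf \<Longrightarrow> wc kl ?w \<le> wc kl w'"
        using u[of kf kl] k by (auto simp: is_arg_min_linorder)
      have N': "\<forall>x\<in>X. \<forall>yb\<in>V kf x. dist yb (ys x) < \<eta>"
          "\<forall>v\<in>Xs. \<exists>w'\<in>Xh kf. wc kl w' \<le> ereal (\<psi> v + \<eta>)"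
          "\<forall>w'\<in>Xh kf. ereal (\<psi> w') \<le> wc kl w'"
        using N[of kf kl] k by simp_all
      have opt: "\<psi> ?w \<le> \<psi> v + \<eta>" if v: "v \<in> Xs" for v
      proof -
        obtain w' where w': "w' \<in> Xh kf" "wc kl w' \<le> ereal (\<psi> v + \<eta>)"
          using bspec[OF N'(2) v] by (elim bexE)
        have "ereal (\<psi> ?w) \<le> wc kl ?w"
          using N'(3) w(1) by (rule bspec)
        also have "\<dots> \<le> wc kl w'"
          using w'(1) by (rule w(2))
        also note w'(2)
        finally show ?thesis by simp
      qed
      obtain x yb t where w_eq: "?w = (x, yb, t)" and mem: "x \<in> X" "yb \<in> V kf x" "t \<in> T"
        using w(1) by (cases "u kl kf") (auto simp: Xh_def extended_leader_set_iff)
      show ?thesis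
      proof (intro exI[of _ ?w] conjI ballI opt)
        show "dist ?w z < \<eta>"
          using k by (simp add: dist_commute)
        show "dist (fst (snd ?w)) (ys (fst ?w)) < \<eta>"
          using N'(1) mem unfolding w_eq by simp
      qed (use mem in \<open>auto simp: w_eq\<close>)
    qed
    then have "\<forall>n. \<exists>w. dist w z < inverse (real (Suc n)) \<and> fst w \<in> X \<and> snd (snd w) \<in> T \<and>
        dist (fst (snd w)) (ys (fst w)) < inverse (real (Suc n)) \<and>
        (\<forall>v\<in>Xs. \<psi> w \<le> \<psi> v + inverse (real (Suc n)))"
      by simp
    then obtain W where W: "\<And>n. dist (W n) z < inverse (real (Suc n))" "\<And>n. fst (W n) \<in> X"
        "\<And>n. snd (snd (W n)) \<in> T" "\<And>n. dist (fst (snd (W n))) (ys (fst (W n))) < inverse (real (Suc n))"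
        "\<And>n v. v \<in> Xs \<Longrightarrow> \<psi> (W n) \<le> \<psi> v + inverse (real (Suc n))"
      by metis
    have to0: "(\<lambda>n. inverse (real (Suc n))) \<longlonglongrightarrow> 0"
      by (rule LIMSEQ_inverse_real_of_nat)
    have "(\<lambda>n. dist (W n) z) \<longlonglongrightarrow> 0"
    proof (rule tendsto_sandwich[OF _ _ tendsto_const to0])
      show "\<forall>\<^sub>F n in sequentially. dist (W n) z \<le> inverse (real (Suc n))"
        by (intro always_eventually allI less_imp_le W(1))
    qed simp
    then have lim: "W \<longlonglongrightarrow> z"
      by (rule tendsto_dist_iff[THEN iffD2])
    have lims: "(\<lambda>n. fst (W n)) \<longlonglongrightarrow> fst z" "(\<lambda>n. fst (snd (W n))) \<longlonglongrightarrow> fst (snd z)"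
        "(\<lambda>n. snd (snd (W n))) \<longlonglongrightarrow> snd (snd z)" "(\<lambda>n. snd (W n)) \<longlonglongrightarrow> snd z"
      using lim by (auto intro!: tendsto_fst tendsto_snd)
    have x: "fst z \<in> X"
      using closed_sequentially[OF finite_imp_closed[OF \<open>finite X\<close>] _ lims(1)] W(2) by blast
    have t: "snd (snd z) \<in> T"
      using closed_sequentially[OF \<open>closed T\<close> _ lims(3)] W(3) by blast
    \<comment> \<open>A finite set is discrete, so the leader decisions along \<open>W\<close> are
      eventually equal to their limit. This takes the place of continuity of
      \<open>ys\<close>.\<close>
    have "open (- (X - {fst z}))"
      using \<open>finite X\<close> by (intro open_Compl finite_imp_closed) auto
    then have ev: "\<forall>\<^sub>F n in sequentially. fst (W n) = fst z"
      using topological_tendstoD[OF lims(1), of "- (X - {fst z})"] W(2)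
      by (auto elim!: eventually_mono)
    have "(\<lambda>n. dist (fst (snd (W n))) (ys (fst z))) \<longlonglongrightarrow> 0"
    proof (rule tendsto_sandwich[OF _ _ tendsto_const to0])
      show "\<forall>\<^sub>F n in sequentially. dist (fst (snd (W n))) (ys (fst z)) \<le> inverse (real (Suc n))"
        using ev by eventually_elim (metis W(4) less_imp_le)
    qed auto
    then have "(\<lambda>n. fst (snd (W n))) \<longlonglongrightarrow> ys (fst z)"
      by (rule tendsto_dist_iff[THEN iffD2])
    then have y: "fst (snd z) = ys (fst z)"
      using lims(2) LIMSEQ_unique by blast
    have z_in: "z \<in> Xs"
      using x y t by (cases z) (auto simp: Xs_def extended_leader_set_def)
    have "(\<lambda>n. dist (\<psi> (W n)) (\<psi> z)) \<longlonglongrightarrow> 0"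
    proof (rule tendsto_sandwich[OF _ _ tendsto_const])
      show "\<forall>\<^sub>F n in sequentially. dist (\<psi> (W n)) (\<psi> z) \<le> K * dist (snd (W n)) (snd z)"
        using K(2) by (simp add: dist_real_def)
      show "(\<lambda>n. K * dist (snd (W n)) (snd z)) \<longlonglongrightarrow> 0"
        by (rule tendsto_mult_right_zero[OF tendsto_dist_iff[THEN iffD1, OF lims(4)]])
    qed auto
    then have "(\<lambda>n. \<psi> (W n)) \<longlonglongrightarrow> \<psi> z"
      by (rule tendsto_dist_iff[THEN iffD2])
    then have "\<psi> z \<le> \<psi> v" if "v \<in> Xs" for v
      using LIMSEQ_le[of _ "\<psi> z" "\<lambda>n. \<psi> v + inverse (real (Suc n))" "\<psi> v + 0"] W(5)[OF that]
        tendsto_add[OF tendsto_const to0] by auto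
    then show ?thesis
      using z_in by (auto simp: is_arg_min_linorder)
  qed
qed

section \<open>Expectations over an ambiguity set\<close>

lemma distributions_onD:
  assumes "Q \<in> distributions_on S"
  shows "sets Q = sets borel" "prob_space Q" "AE c in Q. c \<in> S"
proof -
  show *: "sets Q = sets borel" "prob_space Q"
    using assms by (auto simp: distributions_on_def)
  interpret prob_space Q by fact
  show "AE c in Q. c \<in> S"
    using assms by (intro AE_prob_1) (simp add: distributions_on_def measure_def)
qed

text \<open>Continuity bounds \<open>g\<close> on the compact set that carries the measure. That set
  is \<open>S\<close> for members of an ambiguity set and the finite sample for an empirical
  distribution.\<close>

lemma integrable_continuous_AE_compact:
  fixes g :: "'a::metric_space \<Rightarrow> real"
  assumes "finite_measure Q" "sets Q = sets borel" "AE c in Q. c \<in> K"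
    and "compact K" "continuous_on UNIV g"
  shows "integrable Q g"
proof -
  interpret finite_measure Q by fact
  have "compact (g ` K)"
    using assms by (intro compact_continuous_image) (auto intro: continuous_on_subset)
  from compact_imp_bounded[OF this] obtain M where "\<And>c. c \<in> K \<Longrightarrow> norm (g c) \<le> M"
    by (auto simp: bounded_iff)
  then show ?thesis
    using assms by (intro integrable_const_bound[of _ M])
      (auto elim!: eventually_mono simp: measurable_cong_sets[OF assms(2) refl] borel_measurable_continuous_onI)
qed

text \<open>A finite set is closed, hence Borel, and each Dirac measure in the average vanishes on
  its complement. The sample thus is a compact carrier for any \<open>\<omega>\<close>.\<close>

lemma AE_empirical:
  fixes \<omega> :: "nat \<Rightarrow> real^'n"
  shows "AE c in empirical \<omega> k. c \<in> \<omega> ` {..<k}"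
proof (rule AE_I[where N = "- \<omega> ` {..<k}"])
  have "closed (\<omega> ` {..<k})"
    by (intro finite_imp_closed) auto
  then show "- \<omega> ` {..<k} \<in> sets (empirical \<omega> k)"
    by (auto intro: borel_closed)
  then show "emeasure (empirical \<omega> k) (- \<omega> ` {..<k}) = 0"
    by (subst emeasure_empirical) (auto simp: indicator_def)
qed auto

text \<open>Cauchy-Schwarz gives Euclidean estimates, whereas transport is priced in the sum norm or
  the maximum norm; the square root of the dimension covers both cases.\<close>

lemma norm_le_lp_norm:
  fixes x :: "real^'n"
  assumes "p \<in> {1, \<infinity>}"
  shows "norm x \<le> sqrt (real CARD('n)) * lp_norm p x"
proof (cases "p = \<infinity>")
  case True
  then show ?thesis
    using norm_le_infnorm[of x] by (simp add: lp_norm_def)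
next
  case False
  then have "norm x \<le> lp_norm p x"
    using assms norm_le_l1_cart[of x] by (simp add: lp_norm_1)
  moreover have "1 \<le> sqrt (real CARD('n))"
    by (simp add: Suc_le_eq)
  ultimately show ?thesis
    using norm_ge_zero[of x] mult_right_mono[of 1 "sqrt (real CARD('n))" "lp_norm p x"] by linarith
qed

text \<open>The easy half of Kantorovich duality.\<close>

lemma wasserstein_lipschitz:
  fixes Q1 Q2 :: "(real^'n) measure"
  assumes W: "wasserstein p Q1 Q2 \<le> ennreal \<epsilon>" and "0 \<le> \<epsilon>" "0 < K"
    and g: "integrable Q1 g" "integrable Q2 g" "g \<in> borel_measurable borel"
    and lip: "\<And>c c'. \<bar>g c - g c'\<bar> \<le> K * lp_norm p (c - c')"
  shows "\<bar>(\<integral>c. g c \<partial>Q1) - (\<integral>c. g c \<partial>Q2)\<bar> \<le> K * \<epsilon>"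
proof -
  let ?d = "(\<integral>c. g c \<partial>Q1) - (\<integral>c. g c \<partial>Q2)"
  \<comment> \<open>The bound holds for the cost of every coupling and so passes to the infimum;
    without couplings the infimum is infinite and the bound is trivial.\<close>
  have "ennreal (\<bar>?d\<bar> / K) \<le> wasserstein p Q1 Q2"
    unfolding wasserstein_def
  proof (rule INF_greatest)
    fix \<pi> assume "\<pi> \<in> couplings Q1 Q2"
    then have \<pi>: "sets \<pi> = sets (borel \<Otimes>\<^sub>M borel)" "distr \<pi> borel fst = Q1" "distr \<pi> borel snd = Q2"
      by (auto simp: couplings_def)
    have meas: "fst \<in> measurable \<pi> borel" "snd \<in> measurable \<pi> borel"
      using measurable_cong_sets[OF \<pi>(1) refl] by auto
    have int: "integrable \<pi> (\<lambda>z. g (fst z))" "integrable \<pi> (\<lambda>z. g (snd z))"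
      using g integrable_distr_eq[OF meas(1) g(3)] integrable_distr_eq[OF meas(2) g(3)] by (auto simp: \<pi>)
    have "?d = (\<integral>z. g (fst z) \<partial>\<pi>) - (\<integral>z. g (snd z) \<partial>\<pi>)"
      using integral_distr[OF meas(1) g(3)] integral_distr[OF meas(2) g(3)] by (simp add: \<pi>)
    also have "\<dots> = (\<integral>z. g (fst z) - g (snd z) \<partial>\<pi>)"
      using int by simp
    finally have "\<bar>?d\<bar> / K = norm (\<integral>z. (g (fst z) - g (snd z)) / K \<partial>\<pi>)"
      using \<open>0 < K\<close> by simp
    also have "ennreal \<dots> \<le> (\<integral>\<^sup>+z. norm ((g (fst z) - g (snd z)) / K) \<partial>\<pi>)"
      using int by (intro integral_norm_bound_ennreal) auto
    also have "\<dots> \<le> (\<integral>\<^sup>+z. lp_norm p (fst z - snd z) \<partial>\<pi>)"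
      using lip \<open>0 < K\<close> by (intro nn_integral_mono ennreal_leI) (simp add: field_simps)
    finally show "ennreal (\<bar>?d\<bar> / K) \<le> (\<integral>\<^sup>+z. lp_norm p (fst z - snd z) \<partial>\<pi>)" .
  qed
  then have "ennreal (\<bar>?d\<bar> / K) \<le> ennreal \<epsilon>"
    using W by order
  then show ?thesis
    using \<open>0 \<le> \<epsilon>\<close> \<open>0 < K\<close> by (simp add: field_simps)
qed

text \<open>Truncation by \<open>min\<close> at \<open>0\<close> is 1-Lipschitz, and Cauchy-Schwarz
  does the rest. The constant depends on the decision only through the norm of \<open>y\<close>,
  which is bounded on the feasible sets.\<close>

lemma h\<^sub>f_lipschitz_cost:
  assumes "\<alpha> < 1"
  shows "\<bar>h\<^sub>f \<alpha> yb c - h\<^sub>f \<alpha> yb c'\<bar> \<le> norm (fst yb) / (1 - \<alpha>) * norm (c - c')"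
proof -
  obtain y t where yb: "yb = (y, t)" by fastforce
  have "\<bar>min (c \<bullet> y - t) 0 - min (c' \<bullet> y - t) 0\<bar> \<le> \<bar>(c - c') \<bullet> y\<bar>"
    by (auto simp: inner_diff_left)
  also have "\<dots> \<le> norm y * norm (c - c')"
    using Cauchy_Schwarz_ineq2[of "c - c'" y] by (simp add: mult.commute)
  finally have "\<bar>min (c \<bullet> y - t) 0 - min (c' \<bullet> y - t) 0\<bar> / (1 - \<alpha>) \<le> norm y * norm (c - c') / (1 - \<alpha>)"
    using assms by (intro divide_right_mono) auto
  moreover have "\<bar>h\<^sub>f \<alpha> yb c - h\<^sub>f \<alpha> yb c'\<bar> = \<bar>min (c \<bullet> y - t) 0 - min (c' \<bullet> y - t) 0\<bar> / (1 - \<alpha>)"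
    using assms by (simp add: h\<^sub>f_def yb flip: diff_divide_distrib)
  ultimately show ?thesis by (simp add: yb)
qed

text \<open>The level \<open>t\<close> enters twice: directly, which gives the leading
  \<open>1\<close>, and inside the minimum, which gives the \<open>1\<close> next to
  \<open>norm c\<close>.\<close>

lemma h\<^sub>f_lipschitz_var:
  assumes "\<alpha> < 1"
  shows "\<bar>h\<^sub>f \<alpha> yb c - h\<^sub>f \<alpha> yb' c\<bar> \<le> (1 + (norm c + 1) / (1 - \<alpha>)) * dist yb yb'"
proof -
  obtain y t y' t' where yb: "yb = (y, t)" "yb' = (y', t')" by fastforce
  let ?d = "dist yb yb'"
  have d: "norm (y - y') \<le> ?d" "\<bar>t - t'\<bar> \<le> ?d"
    using dist_fst_le[of yb yb'] dist_snd_le[of yb yb'] by (auto simp: yb dist_norm)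
  have "\<bar>c \<bullet> (y - y')\<bar> \<le> norm c * norm (y - y')"
    by (rule Cauchy_Schwarz_ineq2)
  also have "\<dots> \<le> norm c * ?d"
    using d by (intro mult_left_mono) auto
  finally have "\<bar>min (c \<bullet> y - t) 0 - min (c \<bullet> y' - t') 0\<bar> \<le> (norm c + 1) * ?d"
    using d by (auto simp: inner_diff_right algebra_simps)
  then have "\<bar>min (c \<bullet> y - t) 0 - min (c \<bullet> y' - t') 0\<bar> / (1 - \<alpha>) \<le> (norm c + 1) * ?d / (1 - \<alpha>)"
    using assms by (intro divide_right_mono) auto
  moreover have "\<bar>(min (c \<bullet> y - t) 0 - min (c \<bullet> y' - t') 0) / (1 - \<alpha>)\<bar> = \<bar>min (c \<bullet> y - t) 0 - min (c \<bullet> y' - t') 0\<bar> / (1 - \<alpha>)"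
    using assms by simp
  moreover have "h\<^sub>f \<alpha> yb c - h\<^sub>f \<alpha> yb' c = (t - t') + (min (c \<bullet> y - t) 0 - min (c \<bullet> y' - t') 0) / (1 - \<alpha>)"
    by (simp add: h\<^sub>f_def yb diff_divide_distrib)
  moreover have "(1 + (norm c + 1) / (1 - \<alpha>)) * ?d = ?d + (norm c + 1) * ?d / (1 - \<alpha>)"
    by (simp add: algebra_simps add_divide_distrib)
  ultimately show ?thesis
    using d by linarith
qed

lemma continuous_h\<^sub>f: "continuous_on A (h\<^sub>f \<alpha> yb)"
  unfolding h\<^sub>f_def case_prod_unfold
  by (intro continuous_on_add continuous_on_mult continuous_on_const continuous_on_min
      continuous_on_diff continuous_on_inner continuous_on_id)

text \<open>Changing the signs of \<open>y\<close> and of the leader's level \<open>s\<close>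
  exchanges positive and negative parts, so the estimates for the follower carry over to the leader.
  The follower's level \<open>t\<close> drops out.\<close>

lemma h\<^sub>l_eq_h\<^sub>f: "h\<^sub>l \<alpha> (x, (y, t), s) c = - h\<^sub>f \<alpha> (- y, - s) c"
proof -
  have "max (c \<bullet> y - s) 0 = - min (c \<bullet> - y - - s) 0"
    by (simp add: min_def max_def)
  then show ?thesis
    by (simp add: h\<^sub>l_def h\<^sub>f_def)
qed

lemma \<rho>\<^sub>l_eq_\<rho>\<^sub>f: "\<rho>\<^sub>l \<alpha> y Q = - \<rho>\<^sub>f \<alpha> (- y) Q"
proof -
  have *: "t + 1 / (1 - \<alpha>) * (\<integral>c. max (c \<bullet> y - t) 0 \<partial>Q)
      = - (- t + 1 / (1 - \<alpha>) * (\<integral>c. min (c \<bullet> - y - - t) 0 \<partial>Q))" for t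
  proof -
    have "max (c \<bullet> y - t) 0 = - min (c \<bullet> - y - - t) 0" for c
      by (simp add: min_def max_def)
    then show ?thesis by simp
  qed
  have "\<rho>\<^sub>l \<alpha> y Q = (INF t. - ereal (- t + 1 / (1 - \<alpha>) * (\<integral>c. min (c \<bullet> - y - - t) 0 \<partial>Q)))"
    unfolding \<rho>\<^sub>l_def * by simp
  also have "\<dots> = - (SUP t. ereal (- t + 1 / (1 - \<alpha>) * (\<integral>c. min (c \<bullet> - y - - t) 0 \<partial>Q)))"
    by (rule ereal_INF_uminus_eq)
  \<comment> \<open>Negation maps the real line onto itself, so the supremum may be reindexed by
    it.\<close>
  also have "(SUP t. ereal (- t + 1 / (1 - \<alpha>) * (\<integral>c. min (c \<bullet> - y - - t) 0 \<partial>Q)))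
      = (SUP t\<in>range (uminus :: real \<Rightarrow> real). ereal (t + 1 / (1 - \<alpha>) * (\<integral>c. min (c \<bullet> - y - t) 0 \<partial>Q)))"
    by (simp only: image_image)
  finally show ?thesis
    by (simp add: \<rho>\<^sub>f_def)
qed

text \<open>Passing from \<open>Q\<close> to the worst case costs at most \<open>\<delta>\<close> at
  \<open>yb'\<close>, robust optimality leads on to \<open>yb\<close>, and the way back to
  \<open>Q\<close> is free since \<open>Q\<close> is one of the competing distributions. So
  deviations matter only at \<open>yb'\<close>.\<close>

lemma robust_follower_solutions_near_optimal:
  assumes yb: "yb \<in> robust_follower_solutions \<alpha> K \<Q>" and "Q \<in> \<Q>" "yb' \<in> K"
    and dev: "\<And>Q'. Q' \<in> \<Q> \<Longrightarrow> \<bar>(\<integral>c. h\<^sub>f \<alpha> yb' c \<partial>Q') - (\<integral>c. h\<^sub>f \<alpha> yb' c \<partial>Q)\<bar> \<le> \<delta>"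
  shows "(\<integral>c. h\<^sub>f \<alpha> yb' c \<partial>Q) - \<delta> \<le> (\<integral>c. h\<^sub>f \<alpha> yb c \<partial>Q)"
proof -
  have "ereal ((\<integral>c. h\<^sub>f \<alpha> yb' c \<partial>Q) - \<delta>) \<le> (INF Q'\<in>\<Q>. ereal (\<integral>c. h\<^sub>f \<alpha> yb' c \<partial>Q'))"
    using dev by (intro INF_greatest) (force simp: abs_le_iff)
  also have "\<dots> \<le> (INF Q'\<in>\<Q>. ereal (\<integral>c. h\<^sub>f \<alpha> yb c \<partial>Q'))"
    using yb \<open>yb' \<in> K\<close> unfolding robust_follower_solutions_def is_arg_max_linorder by blast
  also have "\<dots> \<le> ereal (\<integral>c. h\<^sub>f \<alpha> yb c \<partial>Q)"
    using \<open>Q \<in> \<Q>\<close> by (rule INF_lower)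
  finally show ?thesis by simp
qed

section \<open>Expectations of the follower's integrand under distributions on a compact set\<close>

context
  fixes S :: "(real^'n) set" and \<alpha> :: real
  assumes S: "compact S" and \<alpha>: "\<alpha> < 1"
begin

lemma integrable_h\<^sub>f:
  assumes "Q \<in> distributions_on S"
  shows "integrable Q (h\<^sub>f \<alpha> yb)"
  using distributions_onD[OF assms] S
  by (intro integrable_continuous_AE_compact[of Q S] continuous_h\<^sub>f prob_space.finite_measure)

lemma expectation_h\<^sub>f_lipschitz:
  assumes Q: "Q \<in> distributions_on S" and R: "\<And>c. c \<in> S \<Longrightarrow> norm c \<le> R"
  shows "\<bar>(\<integral>c. h\<^sub>f \<alpha> yb c \<partial>Q) - (\<integral>c. h\<^sub>f \<alpha> yb' c \<partial>Q)\<bar> \<le> (1 + (R + 1) / (1 - \<alpha>)) * dist yb yb'"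
proof -
  interpret prob_space Q using distributions_onD[OF Q] by simp
  note int = integrable_h\<^sub>f[OF Q]
  have "AE c in Q. \<bar>h\<^sub>f \<alpha> yb c - h\<^sub>f \<alpha> yb' c\<bar> \<le> (1 + (R + 1) / (1 - \<alpha>)) * dist yb yb'"
    using distributions_onD(3)[OF Q]
  proof eventually_elim
    case (elim c)
    have "(1 + (norm c + 1) / (1 - \<alpha>)) * dist yb yb' \<le> (1 + (R + 1) / (1 - \<alpha>)) * dist yb yb'"
      using R[OF elim] \<alpha> by (intro mult_right_mono add_left_mono divide_right_mono add_right_mono) auto
    then show ?case
      using h\<^sub>f_lipschitz_var[OF \<alpha>, of yb c yb'] by linarith
  qed
  then have "(\<integral>c. \<bar>h\<^sub>f \<alpha> yb c - h\<^sub>f \<alpha> yb' c\<bar> \<partial>Q) \<le> (\<integral>c. (1 + (R + 1) / (1 - \<alpha>)) * dist yb yb' \<partial>Q)"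
    using int by (intro integral_mono_AE) auto
  moreover have "\<bar>\<integral>c. h\<^sub>f \<alpha> yb c - h\<^sub>f \<alpha> yb' c \<partial>Q\<bar> \<le> (\<integral>c. \<bar>h\<^sub>f \<alpha> yb c - h\<^sub>f \<alpha> yb' c\<bar> \<partial>Q)"
    by (rule integral_abs_bound)
  ultimately show ?thesis
    using int by (simp add: prob_space)
qed

text \<open>The constant is common to all distributions on \<open>S\<close>, so it survives the
  infimum over an ambiguity set.\<close>

lemma expectation_h\<^sub>f_lipschitz_ex:
  obtains C where "0 \<le> C" "\<And>Q yb yb'. Q \<in> distributions_on S \<Longrightarrow>
    \<bar>(\<integral>c. h\<^sub>f \<alpha> yb c \<partial>Q) - (\<integral>c. h\<^sub>f \<alpha> yb' c \<partial>Q)\<bar> \<le> C * dist yb yb'"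
proof -
  obtain R where R: "0 < R" "\<And>c. c \<in> S \<Longrightarrow> norm c \<le> R"
    using compact_imp_bounded[OF S] by (auto simp: bounded_pos)
  show ?thesis
    using R \<alpha> expectation_h\<^sub>f_lipschitz[OF _ R(2)] by (intro that[of "1 + (R + 1) / (1 - \<alpha>)"]) auto
qed

lemma continuous_expectation_h\<^sub>f:
  assumes "Q \<in> distributions_on S"
  shows "continuous_on A (\<lambda>yb. \<integral>c. h\<^sub>f \<alpha> yb c \<partial>Q)"
proof -
  obtain C where C: "0 \<le> C" "\<And>yb yb'. \<bar>(\<integral>c. h\<^sub>f \<alpha> yb c \<partial>Q) - (\<integral>c. h\<^sub>f \<alpha> yb' c \<partial>Q)\<bar> \<le> C * dist yb yb'"
    using expectation_h\<^sub>f_lipschitz_ex assms by metis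
  have "C-lipschitz_on A (\<lambda>yb. \<integral>c. h\<^sub>f \<alpha> yb c \<partial>Q)"
    using C by (intro lipschitz_onI) (auto simp: dist_real_def)
  then show ?thesis
    by (rule lipschitz_on_continuous_on)
qed

text \<open>Both distributions are within \<open>\<epsilon>\<close> of the same empirical
  distribution; the factor \<open>2\<close> is the triangle inequality through it.\<close>

lemma ambiguity_set_deviation:
  assumes "p \<in> {1, \<infinity>}" "1 \<le> k" "0 \<le> \<epsilon>" "norm (fst yb) \<le> M"
    and Q: "Q \<in> ambiguity_set S p \<omega> k \<epsilon>" "Q' \<in> ambiguity_set S p \<omega> k \<epsilon>"
  shows "\<bar>(\<integral>c. h\<^sub>f \<alpha> yb c \<partial>Q) - (\<integral>c. h\<^sub>f \<alpha> yb c \<partial>Q')\<bar> \<le> 2 * (sqrt (real CARD('n)) * (M + 1) / (1 - \<alpha>)) * \<epsilon>"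
proof -
  \<comment> \<open>\<open>M + 1\<close> instead of \<open>M\<close> keeps the constant positive, as
    \<open>wasserstein_lipschitz\<close> demands.\<close>
  let ?K = "sqrt (real CARD('n)) * (M + 1) / (1 - \<alpha>)"
  let ?P = "empirical \<omega> k"
  have "0 \<le> M" using assms(4) norm_ge_zero order_trans by blast
  then have K: "0 < ?K" using \<alpha> by (auto intro!: divide_pos_pos mult_pos_pos)
  have lip: "\<bar>h\<^sub>f \<alpha> yb c - h\<^sub>f \<alpha> yb c'\<bar> \<le> ?K * lp_norm p (c - c')" for c c'
  proof -
    have "\<bar>h\<^sub>f \<alpha> yb c - h\<^sub>f \<alpha> yb c'\<bar> \<le> norm (fst yb) / (1 - \<alpha>) * norm (c - c')"
      by (rule h\<^sub>f_lipschitz_cost[OF \<alpha>])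
    also have "\<dots> \<le> (M + 1) / (1 - \<alpha>) * (sqrt (real CARD('n)) * lp_norm p (c - c'))"
      using assms \<open>0 \<le> M\<close> \<alpha> norm_le_lp_norm[OF assms(1)]
      by (intro mult_mono divide_right_mono) auto
    finally show ?thesis by (simp add: mult_ac)
  qed
  have meas: "h\<^sub>f \<alpha> yb \<in> borel_measurable borel"
    by (intro borel_measurable_continuous_onI continuous_h\<^sub>f)
  have intP: "integrable ?P (h\<^sub>f \<alpha> yb)"
    using AE_empirical[of \<omega> k] prob_space_empirical[OF assms(2)]
    by (intro integrable_continuous_AE_compact[of ?P "\<omega> ` {..<k}"] continuous_h\<^sub>f prob_space.finite_measure)
       (auto intro: finite_imp_compact)
  have "\<bar>(\<integral>c. h\<^sub>f \<alpha> yb c \<partial>?P) - (\<integral>c. h\<^sub>f \<alpha> yb c \<partial>Q)\<bar> \<le> ?K * \<epsilon>" if "Q \<in> ambiguity_set S p \<omega> k \<epsilon>" for Q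
    using that intP meas lip K \<open>0 \<le> \<epsilon>\<close>
    by (intro wasserstein_lipschitz[where p = p]) (auto simp: ambiguity_set_def integrable_h\<^sub>f)
  from this[OF Q(1)] this[OF Q(2)] show ?thesis by linarith
qed

text \<open>An infimum of functions with a common Lipschitz constant is again Lipschitz, so the
  robust objective attains its maximum on a compact set.\<close>

lemma robust_follower_solutions_nonempty:
  assumes K: "compact K" "K \<noteq> {}" and \<Q>: "\<Q> \<noteq> {}" "\<Q> \<subseteq> distributions_on S"
  shows "robust_follower_solutions \<alpha> K \<Q> \<noteq> {}"
proof -
  let ?E = "\<lambda>Q yb. \<integral>c. h\<^sub>f \<alpha> yb c \<partial>Q"
  \<comment> \<open>The Lipschitz argument needs a real infimum. Boundedness below, shown next,
    identifies it with the extended real one in the definition of robust solutions.\<close>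
  define g where "g yb = (INF Q\<in>\<Q>. ?E Q yb)" for yb
  have bdd: "bdd_below ((\<lambda>Q. ?E Q yb) ` \<Q>)" for yb
  proof -
    have "compact (h\<^sub>f \<alpha> yb ` S)"
      using S by (intro compact_continuous_image continuous_h\<^sub>f)
    from compact_imp_bounded[OF this] obtain m where m: "\<And>c. c \<in> S \<Longrightarrow> - m \<le> h\<^sub>f \<alpha> yb c"
      by (force simp: bounded_iff abs_le_iff minus_le_iff)
    have "- m \<le> ?E Q yb" if "Q \<in> \<Q>" for Q
    proof -
      have Q: "Q \<in> distributions_on S" using that \<Q> by auto
      interpret prob_space Q using distributions_onD[OF Q] by simp
      show ?thesis
        using integrable_h\<^sub>f[OF Q] distributions_onD(3)[OF Q] m
        by (intro integral_ge_const) (auto elim: eventually_mono)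
    qed
    then show ?thesis by (auto simp: bdd_below_def)
  qed
  obtain C where C: "0 \<le> C" "\<And>Q yb yb'. Q \<in> \<Q> \<Longrightarrow> \<bar>?E Q yb - ?E Q yb'\<bar> \<le> C * dist yb yb'"
    using expectation_h\<^sub>f_lipschitz_ex \<Q>(2) by (metis subsetD)
  have g_le: "g yb - C * dist yb yb' \<le> g yb'" for yb yb'
    unfolding g_def[of yb']
  proof (rule cINF_greatest[OF \<Q>(1)])
    fix Q assume Q: "Q \<in> \<Q>"
    have "g yb \<le> ?E Q yb"
      unfolding g_def using Q by (intro cINF_lower[OF bdd])
    then show "g yb - C * dist yb yb' \<le> ?E Q yb'"
      using C(2)[OF Q, of yb yb'] by linarith
  qed
  have "\<bar>g yb - g yb'\<bar> \<le> C * dist yb yb'" for yb yb'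
    using g_le[of yb yb'] g_le[of yb' yb] by (auto simp: dist_commute)
  then have "C-lipschitz_on K g"
    using C by (intro lipschitz_onI) (auto simp: dist_real_def)
  then have "continuous_on K g"
    by (rule lipschitz_on_continuous_on)
  then obtain yb where yb: "yb \<in> K" "\<And>yb'. yb' \<in> K \<Longrightarrow> g yb' \<le> g yb"
    using continuous_attains_sup[OF K] by blast
  have "(INF Q\<in>\<Q>. ereal (?E Q yb)) = ereal (g yb)" for yb
    using ereal_Inf'[OF bdd[of yb]] \<Q>(1) by (simp add: g_def image_comp)
  then have "yb \<in> robust_follower_solutions \<alpha> K \<Q>"
    using yb by (simp add: robust_follower_solutions_def is_arg_max_linorder)
  then show ?thesis by blast
qed

lemma \<rho>\<^sub>f_eq:
  assumes Q: "Q \<in> distributions_on S"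
  shows "\<rho>\<^sub>f \<alpha> y Q = (SUP t. ereal (\<integral>c. h\<^sub>f \<alpha> (y, t) c \<partial>Q))"
proof -
  interpret prob_space Q using distributions_onD[OF Q] by simp
  have "(\<integral>c. h\<^sub>f \<alpha> (y, t) c \<partial>Q) = t + 1 / (1 - \<alpha>) * (\<integral>c. min (c \<bullet> y - t) 0 \<partial>Q)" for t
  proof -
    have "integrable Q (\<lambda>c. min (c \<bullet> y - t) 0)"
      using distributions_onD[OF Q] S
      by (intro integrable_continuous_AE_compact[of Q S] continuous_intros prob_space.finite_measure)
    then show ?thesis
      by (simp add: h\<^sub>f_def prob_space)
  qed
  then show ?thesis by (simp add: \<rho>\<^sub>f_def)
qed

text \<open>To the left of the range of the cost the objective has slope \<open>1\<close> in \<open>t\<close>, to the right of it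
  slope \<open>1 - 1 / (1 - \<alpha>) \<le> 0\<close>.\<close>

lemma \<rho>\<^sub>f_attained:
  assumes Q: "Q \<in> distributions_on S" and "0 \<le> \<alpha>" "S \<noteq> {}"
    and range: "\<And>c. c \<in> S \<Longrightarrow> c \<bullet> y \<in> {a..b}"
  obtains t where "t \<in> {a..b}" "\<rho>\<^sub>f \<alpha> y Q = ereal (\<integral>c. h\<^sub>f \<alpha> (y, t) c \<partial>Q)"
proof -
  let ?E = "\<lambda>t. \<integral>c. h\<^sub>f \<alpha> (y, t) c \<partial>Q"
  have "a \<le> b" using range \<open>S \<noteq> {}\<close> by fastforce
  have "continuous_on {a..b} ?E"
    by (rule continuous_on_compose2[OF continuous_expectation_h\<^sub>f[OF Q, of UNIV]]) (auto intro!: continuous_intros)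
  then obtain t where t: "t \<in> {a..b}" "\<And>s. s \<in> {a..b} \<Longrightarrow> ?E s \<le> ?E t"
    using continuous_attains_sup[of "{a..b}" ?E] \<open>a \<le> b\<close> by auto
  have mono: "?E s \<le> ?E s'" if "\<And>c. c \<in> S \<Longrightarrow> h\<^sub>f \<alpha> (y, s) c \<le> h\<^sub>f \<alpha> (y, s') c" for s s'
    using integrable_h\<^sub>f[OF Q] distributions_onD(3)[OF Q] that
    by (intro integral_mono_AE) (auto elim: eventually_mono)
  have "?E s \<le> ?E t" for s
  proof -
    consider "s < a" | "s \<in> {a..b}" | "b < s" by fastforce
    then show ?thesis
    proof cases
      case 1
      have "?E s \<le> ?E a"
      proof (rule mono)
        fix c assume "c \<in> S"
        then have "c \<bullet> y \<ge> a" using range by auto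
        then show "h\<^sub>f \<alpha> (y, s) c \<le> h\<^sub>f \<alpha> (y, a) c"
          using 1 by (auto simp: h\<^sub>f_def)
      qed
      then show ?thesis using t(2)[of a] \<open>a \<le> b\<close> by auto
    next
      case 3
      have "?E s \<le> ?E b"
      proof (rule mono)
        fix c assume "c \<in> S"
        then have "c \<bullet> y \<le> b" using range by auto
        \<comment> \<open>Here \<open>0 \<le> \<alpha>\<close> enters: the loss at rate
          \<open>1 / (1 - \<alpha>)\<close> outweighs the direct gain of raising the level.\<close>
        moreover have "(s - b) * 1 \<le> (s - b) * (1 / (1 - \<alpha>))"
          using 3 \<alpha> \<open>0 \<le> \<alpha>\<close> by (intro mult_left_mono) auto
        ultimately show "h\<^sub>f \<alpha> (y, s) c \<le> h\<^sub>f \<alpha> (y, b) c"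
          using 3 by (simp add: h\<^sub>f_def min_def diff_divide_distrib)
      qed
      then show ?thesis using t(2)[of b] \<open>a \<le> b\<close> by auto
    qed (rule t(2))
  qed
  then have "\<rho>\<^sub>f \<alpha> y Q = ereal (?E t)"
    unfolding \<rho>\<^sub>f_eq[OF Q] by (intro antisym SUP_least SUP_upper) auto
  then show ?thesis using t(1) that by blast
qed

end

section \<open>Limits along shrinking ambiguity sets\<close>

context
  fixes S :: "(real^'n) set" and \<alpha> :: real
  assumes S: "compact S" and \<alpha>: "\<alpha> < 1"
begin

text \<open>The deviation is bounded by a fixed multiple of the radius, so one threshold for
  \<open>k\<close> serves all pairs of distributions and all decisions with \<open>y\<close> in the
  ball of radius \<open>M\<close>.\<close>

lemma ambiguity_set_deviation_tendsto:
  assumes p: "p \<in> {1, \<infinity>}" and \<epsilon>: "\<forall>k\<ge>1. 0 \<le> \<epsilon> k" "\<epsilon> \<longlonglongrightarrow> 0" and "0 < \<eta>"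
  shows "\<forall>\<^sub>F k in sequentially. \<forall>Q\<in>ambiguity_set S p \<omega> k (\<epsilon> k). \<forall>Q'\<in>ambiguity_set S p \<omega> k (\<epsilon> k).
    \<forall>yb. norm (fst yb) \<le> M \<longrightarrow> \<bar>(\<integral>c. h\<^sub>f \<alpha> yb c \<partial>Q) - (\<integral>c. h\<^sub>f \<alpha> yb c \<partial>Q')\<bar> \<le> \<eta>"
proof -
  let ?K = "2 * (sqrt (real CARD('n)) * (M + 1) / (1 - \<alpha>))"
  have "(\<lambda>k. ?K * \<epsilon> k) \<longlonglongrightarrow> 0"
    using \<epsilon>(2) by (rule tendsto_mult_right_zero)
  then have "\<forall>\<^sub>F k in sequentially. ?K * \<epsilon> k < \<eta>"
    using \<open>0 < \<eta>\<close> by (rule order_tendstoD)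
  then show ?thesis
    using eventually_ge_at_top[of 1]
  proof eventually_elim
    case (elim k)
    then show ?case
      using ambiguity_set_deviation[OF S \<alpha> p elim(2) \<epsilon>(1)[rule_format, OF elim(2)]] by (meson less_imp_le order_trans)
  qed
qed

text \<open>The gap \<open>\<delta>\<close> of the nominal maximum is fixed first. Robust solutions
  are then nominally optimal up to \<open>\<delta>\<close> as soon as the deviation at the single
  point \<open>y0\<close> is at most \<open>\<delta>\<close>; hence the choice of
  \<open>M\<close>.\<close>

lemma robust_follower_convergence:
  assumes Q: "Q \<in> distributions_on S" and p: "p \<in> {1, \<infinity>}"
    and \<epsilon>: "\<forall>k\<ge>1. 0 \<le> \<epsilon> k" "\<epsilon> \<longlonglongrightarrow> 0"
    and ev: "\<forall>\<^sub>F k in sequentially. Q \<in> ambiguity_set S p \<omega> k (\<epsilon> k)"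
    and K: "compact K" "nominal_follower_solutions \<alpha> K Q = {y0}" and "0 < \<eta>"
  shows "\<forall>\<^sub>F k in sequentially. \<forall>yb\<in>robust_follower_solutions \<alpha> K (ambiguity_set S p \<omega> k (\<epsilon> k)). dist yb y0 < \<eta>"
proof -
  let ?E = "\<lambda>yb. \<integral>c. h\<^sub>f \<alpha> yb c \<partial>Q"
  have "is_arg_max ?E (\<lambda>yb. yb \<in> K) yb \<longleftrightarrow> yb = y0" for yb
    using K(2) by (auto simp: nominal_follower_solutions_def)
  \<comment> \<open>A feasible point whose value reaches that of the maximiser \<open>y0\<close> is
    itself a maximiser, hence equal to \<open>y0\<close>.\<close>
  then have y0: "y0 \<in> K" "\<And>yb. yb \<in> K \<Longrightarrow> ?E y0 \<le> ?E yb \<Longrightarrow> yb = y0"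
    unfolding is_arg_max_linorder by (blast intro: order_trans)+
  obtain \<delta> where \<delta>: "0 < \<delta>" "\<And>yb. yb \<in> K \<Longrightarrow> ?E y0 - \<delta> \<le> ?E yb \<Longrightarrow> dist yb y0 < \<eta>"
    using well_separated_maximum[OF K(1) continuous_expectation_h\<^sub>f[OF S \<alpha> Q] \<open>0 < \<eta>\<close> y0(2)] by blast
  show ?thesis
    using ev ambiguity_set_deviation_tendsto[OF p \<epsilon> \<delta>(1), where \<omega> = \<omega> and M = "norm (fst y0)"]
  proof eventually_elim
    case (elim k)
    show ?case
    proof
      fix yb assume yb: "yb \<in> robust_follower_solutions \<alpha> K (ambiguity_set S p \<omega> k (\<epsilon> k))"
      have "?E y0 - \<delta> \<le> ?E yb"
        using elim(2) by (intro robust_follower_solutions_near_optimal[OF yb elim(1) y0(1)]) (use elim(1) in blast)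
      then show "dist yb y0 < \<eta>"
        using yb by (intro \<delta>(2)) (auto simp: robust_follower_solutions_def is_arg_max_linorder)
    qed
  qed
qed

text \<open>The cost involves only \<open>y\<close> and the leader's level. Leaving out the
  follower's level can only decrease the distance, and a change of signs preserves it.\<close>

lemma expectation_h\<^sub>l_lipschitz_ex:
  assumes "Q \<in> distributions_on S"
  shows "\<exists>C. \<forall>(w :: ('m::finite, 'n) leader_var) (w' :: ('m, 'n) leader_var).
    \<bar>(\<integral>c. h\<^sub>l \<alpha> w c \<partial>Q) - (\<integral>c. h\<^sub>l \<alpha> w' c \<partial>Q)\<bar> \<le> C * dist (snd w) (snd w')"
proof -
  obtain C where C: "0 \<le> C"
    "\<And>yb yb'. \<bar>(\<integral>c. h\<^sub>f \<alpha> yb c \<partial>Q) - (\<integral>c. h\<^sub>f \<alpha> yb' c \<partial>Q)\<bar> \<le> C * dist yb yb'"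
    using expectation_h\<^sub>f_lipschitz_ex[OF S \<alpha>] assms by metis
  have lip: "\<bar>(\<integral>c. h\<^sub>l \<alpha> w c \<partial>Q) - (\<integral>c. h\<^sub>l \<alpha> w' c \<partial>Q)\<bar> \<le> C * dist (snd w) (snd w')"
    for w w' :: "('m, 'n) leader_var"
  proof -
    obtain x y t s x' y' t' s' where w: "w = (x, (y, t), s)" "w' = (x', (y', t'), s')"
      by (cases w, cases w') auto
    have "dist y y' \<le> dist (y, t) (y', t')"
      using dist_fst_le[of "(y, t)" "(y', t')"] by simp
    then have "dist (- y, - s) (- y', - s') \<le> dist (snd w) (snd w')"
      unfolding w snd_conv dist_Pair_Pair[of "(y, t)"] dist_Pair_Pair[of "- y"] dist_minus
      by (intro real_sqrt_le_mono add_right_mono power_mono) auto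
    then have "C * dist (- y, - s) (- y', - s') \<le> C * dist (snd w) (snd w')"
      using C(1) by (rule mult_left_mono)
    then show ?thesis
      using C(2)[of "(- y, - s)" "(- y', - s')"] by (simp add: w h\<^sub>l_eq_h\<^sub>f)
  qed
  show ?thesis by (intro exI[of _ C] allI lip)
qed

text \<open>The deviation bound is applied at \<open>(- y, - s)\<close>, which lies in the same norm
  ball because that ball is symmetric.\<close>

lemma worst_case_leader_cost_le:
  fixes w :: "('m::finite, 'n) leader_var"
  assumes "\<And>Q' yb. Q' \<in> \<Q> \<Longrightarrow> norm (fst yb) \<le> M \<Longrightarrow>
      \<bar>(\<integral>c. h\<^sub>f \<alpha> yb c \<partial>Q') - (\<integral>c. h\<^sub>f \<alpha> yb c \<partial>Q)\<bar> \<le> \<eta>"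
    and "norm (fst (fst (snd w))) \<le> M"
  shows "worst_case_leader_cost \<alpha> \<Q> w \<le> ereal ((\<integral>c. h\<^sub>l \<alpha> w c \<partial>Q) + \<eta>)"
  unfolding worst_case_leader_cost_def
proof (rule SUP_least)
  fix Q' assume Q': "Q' \<in> \<Q>"
  obtain x y t s where w: "w = (x, (y, t), s)"
    by (cases w) auto
  show "ereal (\<integral>c. h\<^sub>l \<alpha> w c \<partial>Q') \<le> ereal ((\<integral>c. h\<^sub>l \<alpha> w c \<partial>Q) + \<eta>)"
    using assms(1)[OF Q', of "(- y, - s)"] assms(2) by (simp add: w h\<^sub>l_eq_h\<^sub>f)
qed

end

section \<open>Reformulation of the conditional values at risk\<close>

text \<open>Joint maximisation over \<open>(y, t)\<close> is maximisation over \<open>t\<close>,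
  which yields \<open>\<rho>\<^sub>f\<close>, followed by maximisation over \<open>y\<close>.
  Uniqueness of the pair makes the feasible set of \<open>[SI]\<close> the graph of
  \<open>x \<mapsto> fst (ys x)\<close>, and the change of signs handles the leader's level.\<close>

lemma SI_value_eq:
  fixes ys :: "real^'m \<Rightarrow> 'n::finite follower_var"
  assumes S: "compact S" "S \<noteq> {}" and Q: "Q \<in> distributions_on S"
    and \<alpha>: "0 \<le> \<alpha>l" "\<alpha>l < 1" "0 \<le> \<alpha>f" "\<alpha>f < 1"
    and T: "T = {a..b}" "\<And>x y c. x \<in> X \<Longrightarrow> y \<in> Y x \<Longrightarrow> c \<in> S \<Longrightarrow> c \<bullet> y \<in> T"
    and ys: "\<And>x. x \<in> X \<Longrightarrow> nominal_follower_solutions \<alpha>f (Y x \<times> T) Q = {ys x}"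
  shows "(INF w\<in>extended_leader_set X (\<lambda>x. {ys x}) T. ereal (\<integral>c. h\<^sub>l \<alpha>l w c \<partial>Q)) = SI_value \<alpha>l \<alpha>f X Y Q"
proof -
  let ?E = "\<lambda>\<alpha> yb. \<integral>c. h\<^sub>f \<alpha> yb c \<partial>Q"
  have E_le: "ereal (?E \<alpha> (y, t)) \<le> \<rho>\<^sub>f \<alpha> y Q" if "\<alpha> < 1" for \<alpha> y t
    unfolding \<rho>\<^sub>f_eq[OF S(1) that Q] by (rule SUP_upper) simp
  have attained: "\<exists>t\<in>T. \<rho>\<^sub>f \<alpha>f y Q = ereal (?E \<alpha>f (y, t))" if "x \<in> X" "y \<in> Y x" for x y
  proof -
    have "c \<bullet> y \<in> {a..b}" if "c \<in> S" for c
      using T(2)[OF \<open>x \<in> X\<close> \<open>y \<in> Y x\<close> that] T(1) by simp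
    from \<rho>\<^sub>f_attained[OF S(1) \<alpha>(4) Q \<alpha>(3) S(2) this] show ?thesis
      using T(1) by metis
  qed
  have max_iff: "is_arg_max (?E \<alpha>f) (\<lambda>yb. yb \<in> Y x \<times> T) yb \<longleftrightarrow> yb = ys x" if "x \<in> X" for x yb
    using ys[OF that] by (auto simp: nominal_follower_solutions_def)
  have ys_max: "ys x \<in> Y x \<times> T" "\<And>yb. yb \<in> Y x \<times> T \<Longrightarrow> ?E \<alpha>f yb \<le> ?E \<alpha>f (ys x)" if "x \<in> X" for x
    using max_iff[OF that, of "ys x"] unfolding is_arg_max_linorder by blast+
  have "is_arg_max (\<lambda>y'. \<rho>\<^sub>f \<alpha>f y' Q) (\<lambda>y'. y' \<in> Y x) y \<longleftrightarrow> y = fst (ys x)" if x: "x \<in> X" for x y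
  proof
    assume y: "is_arg_max (\<lambda>y'. \<rho>\<^sub>f \<alpha>f y' Q) (\<lambda>y'. y' \<in> Y x) y"
    then have "y \<in> Y x" by (simp add: is_arg_max_def)
    then obtain t where t: "t \<in> T" "\<rho>\<^sub>f \<alpha>f y Q = ereal (?E \<alpha>f (y, t))"
      using attained[OF x] by blast
    \<comment> \<open>An optimal \<open>y\<close> together with its optimal level is a joint
      maximiser, hence the unique one.\<close>
    have "?E \<alpha>f yb \<le> ?E \<alpha>f (y, t)" if "yb \<in> Y x \<times> T" for yb
    proof -
      have "ereal (?E \<alpha>f yb) \<le> \<rho>\<^sub>f \<alpha>f (fst yb) Q"
        using E_le[OF \<alpha>(4), of "fst yb" "snd yb"] by simp
      also have "\<dots> \<le> ereal (?E \<alpha>f (y, t))"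
        using y that unfolding t(2)[symmetric] is_arg_max_linorder by auto
      finally show ?thesis by simp
    qed
    then have "(y, t) = ys x"
      using \<open>y \<in> Y x\<close> t max_iff[OF x, of "(y, t)"] unfolding is_arg_max_linorder by blast
    then show "y = fst (ys x)" by (metis fst_conv)
  next
    assume y: "y = fst (ys x)"
    have "\<rho>\<^sub>f \<alpha>f y' Q \<le> \<rho>\<^sub>f \<alpha>f y Q" if y': "y' \<in> Y x" for y'
    proof -
      obtain t where t: "t \<in> T" "\<rho>\<^sub>f \<alpha>f y' Q = ereal (?E \<alpha>f (y', t))"
        using attained[OF x y'] by blast
      have "?E \<alpha>f (y', t) \<le> ?E \<alpha>f (y, snd (ys x))"
        using ys_max(2)[OF x, of "(y', t)"] y' t(1) by (simp add: y)
      then have "\<rho>\<^sub>f \<alpha>f y' Q \<le> ereal (?E \<alpha>f (y, snd (ys x)))"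
        by (simp add: t)
      also note E_le[OF \<alpha>(4)]
      finally show ?thesis .
    qed
    then show "is_arg_max (\<lambda>y'. \<rho>\<^sub>f \<alpha>f y' Q) (\<lambda>y'. y' \<in> Y x) y"
      using ys_max(1)[OF x] by (auto simp: is_arg_max_linorder y mem_Times_iff)
  qed
  then have "SI_feasible \<alpha>f X Y Q = (\<lambda>x. (x, fst (ys x))) ` X"
    by (auto simp: SI_feasible_def)
  then have SI: "SI_value \<alpha>l \<alpha>f X Y Q = (INF x\<in>X. \<rho>\<^sub>l \<alpha>l (fst (ys x)) Q)"
    by (simp add: SI_value_def image_comp comp_def)
  have h\<^sub>l_eq: "(\<integral>c. h\<^sub>l \<alpha>l (x, ys x, s) c \<partial>Q) = - ?E \<alpha>l (- fst (ys x), - s)" for x s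
    by (cases "ys x") (simp add: h\<^sub>l_eq_h\<^sub>f)
  show ?thesis
    unfolding SI
  proof (rule antisym)
    show "(INF w\<in>extended_leader_set X (\<lambda>x. {ys x}) T. ereal (\<integral>c. h\<^sub>l \<alpha>l w c \<partial>Q))
        \<le> (INF x\<in>X. \<rho>\<^sub>l \<alpha>l (fst (ys x)) Q)"
    proof (rule INF_greatest)
      fix x assume x: "x \<in> X"
      then have "fst (ys x) \<in> Y x"
        using ys_max(1) by (auto simp: mem_Times_iff)
      \<comment> \<open>The change of signs reflects the interval of costs; a level \<open>t\<close>
        found in the reflected interval gives the leader's level \<open>- t\<close> in
        \<open>T\<close>.\<close>
      then have range: "c \<bullet> - fst (ys x) \<in> {- b..- a}" if "c \<in> S" for c
        using T(2)[OF x _ that] T(1) by simp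
      obtain t where t: "t \<in> {- b..- a}" "\<rho>\<^sub>f \<alpha>l (- fst (ys x)) Q = ereal (?E \<alpha>l (- fst (ys x), t))"
        by (rule \<rho>\<^sub>f_attained[OF S(1) \<alpha>(2) Q \<alpha>(1) S(2) range])
      then have "ereal (\<integral>c. h\<^sub>l \<alpha>l (x, ys x, - t) c \<partial>Q) = \<rho>\<^sub>l \<alpha>l (fst (ys x)) Q"
        unfolding h\<^sub>l_eq \<rho>\<^sub>l_eq_\<rho>\<^sub>f by simp
      moreover have "(x, ys x, - t) \<in> extended_leader_set X (\<lambda>x. {ys x}) T"
        using x t(1) T(1) by (auto simp: extended_leader_set_iff)
      ultimately show "(INF w\<in>extended_leader_set X (\<lambda>x. {ys x}) T. ereal (\<integral>c. h\<^sub>l \<alpha>l w c \<partial>Q))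
          \<le> \<rho>\<^sub>l \<alpha>l (fst (ys x)) Q"
        by (metis INF_lower)
    qed
    show "(INF x\<in>X. \<rho>\<^sub>l \<alpha>l (fst (ys x)) Q)
        \<le> (INF w\<in>extended_leader_set X (\<lambda>x. {ys x}) T. ereal (\<integral>c. h\<^sub>l \<alpha>l w c \<partial>Q))"
    proof (rule INF_greatest)
      fix w assume "w \<in> extended_leader_set X (\<lambda>x. {ys x}) T"
      then obtain x s where w: "w = (x, ys x, s)" and x: "x \<in> X"
        by (auto simp: extended_leader_set_def)
      have "- \<rho>\<^sub>f \<alpha>l (- fst (ys x)) Q \<le> - ereal (?E \<alpha>l (- fst (ys x), - s))"
        using E_le[OF \<alpha>(2)] by (simp only: ereal_minus_le_minus)
      then have "\<rho>\<^sub>l \<alpha>l (fst (ys x)) Q \<le> ereal (\<integral>c. h\<^sub>l \<alpha>l w c \<partial>Q)"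
        unfolding w h\<^sub>l_eq \<rho>\<^sub>l_eq_\<rho>\<^sub>f by simp
      then show "(INF x\<in>X. \<rho>\<^sub>l \<alpha>l (fst (ys x)) Q) \<le> ereal (\<integral>c. h\<^sub>l \<alpha>l w c \<partial>Q)"
        using x by (rule INF_lower2[rotated])
    qed
  qed
qed

section \<open>Feasible sets and almost sure coverage\<close>

lemma finite_leader_feasible: "finite (leader_feasible H h)"
proof (rule finite_subset)
  show "leader_feasible H h \<subseteq> vec_lambda ` (UNIV \<rightarrow>\<^sub>E {0, 1})"
  proof
    fix x assume "x \<in> leader_feasible H h"
    then have "vec_nth x \<in> UNIV \<rightarrow>\<^sub>E {0, 1}"
      by (auto simp: leader_feasible_def)
    then show "x \<in> vec_lambda ` (UNIV \<rightarrow>\<^sub>E {0, 1})"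
      by (intro image_eqI[of _ _ "vec_nth x"]) auto
  qed
qed (intro finite_imageI finite_PiE, auto)

lemma closed_follower_feasible:
  fixes F :: "real^'n^'q"
  shows "closed (follower_feasible F L f x)"
proof -
  have "continuous_on UNIV (\<lambda>y. F *v y + L *v x)"
    by (intro continuous_on_add matrix_vector_mult_linear_continuous_on continuous_on_const)
  then have "closed {y. (F *v y + L *v x) $ i \<le> f $ i}" for i
    by (intro closed_Collect_le continuous_on_component continuous_on_const)
  moreover have "closed {y :: real^'n. 0 \<le> y $ i}" for i
    by (intro closed_Collect_le continuous_on_component continuous_on_const continuous_on_id)
  moreover have "follower_feasible F L f x = (\<Inter>i. {y. 0 \<le> y $ i}) \<inter> (\<Inter>i. {y. (F *v y + L *v x) $ i \<le> f $ i})"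
    by (auto simp: follower_feasible_def less_eq_vec_def)
  ultimately show ?thesis
    by (simp add: closed_INT closed_Int)
qed

text \<open>The infima and suprema in \<open>t_range\<close> are real, so bounds must be supplied:
  compactness of \<open>S \<times> Y x\<close> for the inner ones, finiteness of \<open>X\<close>
  for the outer ones.\<close>

lemma inner_in_t_range:
  assumes "finite X" "compact S" "\<And>x. x \<in> X \<Longrightarrow> compact (Y x)" "x \<in> X" "y \<in> Y x" "c \<in> S"
  shows "c \<bullet> y \<in> t_range X Y S"
proof -
  have "compact ((\<lambda>(c, y). c \<bullet> y) ` (S \<times> Y x))"
    using assms by (intro compact_continuous_image compact_Times)
      (auto simp: case_prod_unfold intro!: continuous_intros)
  from compact_imp_bounded[OF this]
  have bdd: "bdd_below ((\<lambda>(c, y). c \<bullet> y) ` (S \<times> Y x))" "bdd_above ((\<lambda>(c, y). c \<bullet> y) ` (S \<times> Y x))"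
    by (auto intro: bounded_imp_bdd_below bounded_imp_bdd_above)
  have in_img: "c \<bullet> y \<in> (\<lambda>(c, y). c \<bullet> y) ` (S \<times> Y x)"
    using assms by force
  have fin: "finite ((\<lambda>x. INF (c, y)\<in>S \<times> Y x. c \<bullet> y) ` X)" "finite ((\<lambda>x. SUP (c, y)\<in>S \<times> Y x. c \<bullet> y) ` X)"
    using \<open>finite X\<close> by auto
  have "(INF x\<in>X. INF (c, y)\<in>S \<times> Y x. c \<bullet> y) \<le> c \<bullet> y"
    by (rule cINF_lower2[OF bdd_below_finite[OF fin(1)] \<open>x \<in> X\<close> cInf_lower[OF in_img bdd(1)]])
  moreover have "c \<bullet> y \<le> (SUP x\<in>X. SUP (c, y)\<in>S \<times> Y x. c \<bullet> y)"
    by (rule cSUP_upper2[OF bdd_above_finite[OF fin(2)] \<open>x \<in> X\<close> cSup_upper[OF in_img bdd(2)]])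
  ultimately show ?thesis
    by (simp add: t_range_def)
qed

text \<open>A set of positive measure is measurable, as \<open>measure\<close> vanishes on non-measurable sets.\<close>

lemma (in prob_space) AE_eventually_of_prob:
  assumes P: "\<And>k. 1 \<le> k \<Longrightarrow> 1 - \<theta> k \<le> prob {\<omega> \<in> space M. P \<omega> k}"
    and \<theta>: "\<And>k. 1 \<le> k \<Longrightarrow> \<theta> k < 1" "summable \<theta>"
  shows "AE \<omega> in M. \<forall>\<^sub>F k in sequentially. P \<omega> k"
proof -
  \<comment> \<open>The index is shifted by one because the hypotheses speak only of
    \<open>k \<ge> 1\<close>.\<close>
  define A where "A k = space M - {\<omega> \<in> space M. P \<omega> (Suc k)}" for k
  have ev: "{\<omega> \<in> space M. P \<omega> (Suc k)} \<in> events" for k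
    using P[of "Suc k"] \<theta>(1)[of "Suc k"] measure_notin_sets by fastforce
  have "prob (A k) \<le> \<theta> (Suc k)" for k
    using prob_compl[OF ev[of k]] P[of "Suc k"] by (simp add: A_def)
  then have "summable (\<lambda>k. prob (A k))"
    using \<theta>(2) by (intro summable_comparison_test[OF _ iffD2[OF summable_Suc_iff \<theta>(2)]]) auto
  then have "AE \<omega> in M. \<forall>\<^sub>F k in sequentially. \<omega> \<in> space M - A k"
    using ev by (intro borel_cantelli_AE1) (auto simp: A_def emeasure_eq_measure)
  then show ?thesis
  proof eventually_elim
    case (elim \<omega>)
    then have "\<forall>\<^sub>F k in sequentially. P \<omega> (Suc k)"
      by eventually_elim (simp add: A_def)
    then show ?case
      by (simp add: eventually_sequentially_Suc[of "P \<omega>"])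
  qed
qed

section \<open>Asymptotic consistency of the robust bilevel problem\<close>

theorem theorem2:
  fixes H :: "real^'m^'r" and h :: "real^'r"
    and F :: "real^'n^'q" and L :: "real^'m^'q" and f :: "real^'q"
    and B :: "real^'n^'s" and b :: "real^'s"
    and p :: ereal and \<alpha>l \<alpha>f :: real
    and Qstar :: "(real^'n) measure"
    and \<theta>l \<theta>f :: "nat \<Rightarrow> real" and \<epsilon>l \<epsilon>f :: "nat \<Rightarrow> real \<Rightarrow> real"
  defines "X \<equiv> leader_feasible H h"
    and "Y \<equiv> follower_feasible F L f"
    and "S \<equiv> polyhedral_set B b"
    and "Qinf \<equiv> Pi\<^sub>M (UNIV :: nat set) (\<lambda>_. Qstar)"
  defines "T \<equiv> t_range X Y S"
    and "Ql \<equiv> \<lambda>\<omega> k. ambiguity_set S p \<omega> k (\<epsilon>l k (\<theta>l k))"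
    and "Qf \<equiv> \<lambda>\<omega> k. ambiguity_set S p \<omega> k (\<epsilon>f k (\<theta>f k))"
  defines "Xhat \<equiv> \<lambda>\<omega> kf. extended_leader_set X
                    (\<lambda>x. robust_follower_solutions \<alpha>f (Y x \<times> T) (Qf \<omega> kf)) T"
    and "Xstar \<equiv> extended_leader_set X
                    (\<lambda>x. nominal_follower_solutions \<alpha>f (Y x \<times> T) Qstar) T"
  defines "zhat \<equiv> \<lambda>\<omega> kl kf. INF xbar\<in>Xhat \<omega> kf. worst_case_leader_cost \<alpha>l (Ql \<omega> kl) xbar"
    and "zstar \<equiv> INF xbar\<in>Xstar. ereal (\<integral>c. h\<^sub>l \<alpha>l xbar c \<partial>Qstar)"
  assumes p: "p \<in> {1, \<infinity>}"
    and \<alpha>: "\<alpha>l \<in> {0<..<1}" "\<alpha>f \<in> {0<..<1}"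
    and Qstar: "Qstar \<in> distributions_on S"
    and A1: "X \<noteq> {}" "bounded X" "\<And>x. x \<in> X \<Longrightarrow> Y x \<noteq> {} \<and> bounded (Y x)"
    and A2: "S \<noteq> {}" "compact S" "measure_support Qstar = S"
    and A4_levels: "\<And>k. k \<ge> 1 \<Longrightarrow> \<theta>l k \<in> {0<..<1}" "\<And>k. k \<ge> 1 \<Longrightarrow> \<theta>f k \<in> {0<..<1}"
    and A4_radii: "\<And>k. k \<ge> 1 \<Longrightarrow> 0 \<le> \<epsilon>l k (\<theta>l k)" "\<And>k. k \<ge> 1 \<Longrightarrow> 0 \<le> \<epsilon>f k (\<theta>f k)"
    and A4_prob: "\<And>k. k \<ge> 1 \<Longrightarrow> measure Qinf {\<omega> \<in> space Qinf. Qstar \<in> Ql \<omega> k} \<ge> 1 - \<theta>l k"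
                 "\<And>k. k \<ge> 1 \<Longrightarrow> measure Qinf {\<omega> \<in> space Qinf. Qstar \<in> Qf \<omega> k} \<ge> 1 - \<theta>f k"
    and A4_sum: "summable \<theta>l" "summable \<theta>f"
    and A4_lim: "(\<lambda>k. \<epsilon>l k (\<theta>l k)) \<longlonglongrightarrow> 0" "(\<lambda>k. \<epsilon>f k (\<theta>f k)) \<longlonglongrightarrow> 0"
    and A5: "\<And>x. x \<in> X \<Longrightarrow> \<exists>!ybar. ybar \<in> nominal_follower_solutions \<alpha>f (Y x \<times> T) Qstar"
  shows "(AE \<omega> in Qinf. limsup (\<lambda>kf. limsup (\<lambda>kl. zhat \<omega> kl kf)) = zstar)
       \<and> zstar = SI_value \<alpha>l \<alpha>f X Y Qstar
       \<and> (\<forall>xs :: (nat \<Rightarrow> real^'n) \<Rightarrow> nat \<Rightarrow> nat \<Rightarrow> ('m, 'n) leader_var.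
            (\<forall>kl kf. 1 \<le> kf \<longrightarrow> kf \<le> kl \<longrightarrow>
               (AE \<omega> in Qinf. is_arg_min (worst_case_leader_cost \<alpha>l (Ql \<omega> kl))
                                 (\<lambda>xbar. xbar \<in> Xhat \<omega> kf) (xs \<omega> kl kf))) \<longrightarrow>
            (AE \<omega> in Qinf. \<forall>z. accumulation_point (xs \<omega>) z \<longrightarrow>
               is_arg_min (\<lambda>xbar. \<integral>c. h\<^sub>l \<alpha>l xbar c \<partial>Qstar) (\<lambda>xbar. xbar \<in> Xstar) z))"
proof -
  have S: "compact S" "S \<noteq> {}" and \<alpha>': "\<alpha>l < 1" "\<alpha>f < 1" "0 \<le> \<alpha>l" "0 \<le> \<alpha>f"
    using A2 \<alpha> by auto
  have X: "finite X"
    unfolding X_def by (rule finite_leader_feasible)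
  have Y: "compact (Y x)" if "x \<in> X" for x
    using A1(3)[OF that] closed_follower_feasible unfolding Y_def by (auto simp: compact_eq_bounded_closed)
  obtain a b where T: "T = {a..b}"
    unfolding T_def t_range_def by blast
  have in_T: "c \<bullet> y \<in> T" if "x \<in> X" "y \<in> Y x" "c \<in> S" for x y c
    unfolding T_def using that by (intro inner_in_t_range[where X = X and Y = Y] X S(1) Y)
  have YT: "compact (Y x \<times> T)" "Y x \<times> T \<noteq> {}" if x: "x \<in> X" for x
  proof -
    show "compact (Y x \<times> T)"
      using Y[OF x] by (simp add: T compact_Times)
    show "Y x \<times> T \<noteq> {}"
      using A1(3)[OF x] S(2) in_T[OF x] by blast
  qed
  \<comment> \<open>Assumption \<open>A5\<close> makes this description meaningful for
    \<open>x \<in> X\<close>; values elsewhere do not matter.\<close>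
  define ys where "ys x = (THE yb. yb \<in> nominal_follower_solutions \<alpha>f (Y x \<times> T) Qstar)" for x
  have ys: "nominal_follower_solutions \<alpha>f (Y x \<times> T) Qstar = {ys x}" if "x \<in> X" for x
    using theI'[OF A5[OF that]] A5[OF that] unfolding ys_def by blast
  have Xstar: "Xstar = extended_leader_set X (\<lambda>x. {ys x}) T"
    using ys by (auto simp: Xstar_def extended_leader_set_def)
  define \<psi> :: "('m, 'n) leader_var \<Rightarrow> real" where "\<psi> w = (\<integral>c. h\<^sub>l \<alpha>l w c \<partial>Qstar)" for w
  obtain C where C: "\<And>w w'. \<bar>\<psi> w - \<psi> w'\<bar> \<le> C * dist (snd w) (snd w')"
    using expectation_h\<^sub>l_lipschitz_ex[OF S(1) \<alpha>'(1) Qstar, where 'm = 'm] unfolding \<psi>_def by blast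
  have "bounded (\<Union>x\<in>X. Y x)"
    using X A1(3) by (intro bounded_UN) auto
  then obtain M where M: "\<And>x y. x \<in> X \<Longrightarrow> y \<in> Y x \<Longrightarrow> norm y \<le> M"
    by (auto simp: bounded_iff)
  \<comment> \<open>\<open>D\<close> contains the robust feasible sets of all sample sizes, and its
    bound on \<open>y\<close> makes the convergence of the leader's costs uniform.\<close>
  define D where "D = {w :: ('m, 'n) leader_var. norm (fst (fst (snd w))) \<le> M}"
  have \<epsilon>: "\<forall>k\<ge>1. 0 \<le> \<epsilon>l k (\<theta>l k)" "\<forall>k\<ge>1. 0 \<le> \<epsilon>f k (\<theta>f k)"
    using A4_radii by auto

  interpret Qinf: prob_space Qinf
    unfolding Qinf_def using distributions_onD(2)[OF Qstar] by (intro prob_space_PiM)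
  have AE_l: "AE \<omega> in Qinf. \<forall>\<^sub>F k in sequentially. Qstar \<in> Ql \<omega> k"
    by (rule Qinf.AE_eventually_of_prob[where \<theta> = \<theta>l]) (use A4_levels(1) A4_prob(1) A4_sum(1) in auto)
  have AE_f: "AE \<omega> in Qinf. \<forall>\<^sub>F k in sequentially. Qstar \<in> Qf \<omega> k"
    by (rule Qinf.AE_eventually_of_prob[where \<theta> = \<theta>f]) (use A4_levels(2) A4_prob(2) A4_sum(2) in auto)

  \<comment> \<open>For a fixed sample path the argument is deterministic; probability enters only
    through the two coverage events.\<close>
  have conv: "limsup (\<lambda>kf. limsup (\<lambda>kl. zhat \<omega> kl kf)) = zstar"
    "\<And>u z. (\<And>kl kf. 1 \<le> kf \<Longrightarrow> kf \<le> kl \<Longrightarrow>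
        is_arg_min (worst_case_leader_cost \<alpha>l (Ql \<omega> kl)) (\<lambda>xbar. xbar \<in> Xhat \<omega> kf) (u kl kf)) \<Longrightarrow>
      accumulation_point u z \<Longrightarrow> is_arg_min \<psi> (\<lambda>xbar. xbar \<in> Xstar) z"
    if l: "\<forall>\<^sub>F k in sequentially. Qstar \<in> Ql \<omega> k" and f: "\<forall>\<^sub>F k in sequentially. Qstar \<in> Qf \<omega> k" for \<omega>
  proof -
    let ?V = "\<lambda>k x. robust_follower_solutions \<alpha>f (Y x \<times> T) (Qf \<omega> k)"
    let ?wc = "\<lambda>k. worst_case_leader_cost \<alpha>l (Ql \<omega> k) :: ('m, 'n) leader_var \<Rightarrow> ereal"
    have V_ne: "\<forall>\<^sub>F k in sequentially. \<forall>x\<in>X. ?V k x \<noteq> {}"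
      using f
    proof eventually_elim
      case (elim k)
      have "Qf \<omega> k \<subseteq> distributions_on S"
        by (auto simp: Qf_def ambiguity_set_def)
      then show ?case
        using elim YT by (intro ballI robust_follower_solutions_nonempty[OF S(1) \<alpha>'(2)]) auto
    qed
    \<comment> \<open>Finiteness of \<open>X\<close> merges the thresholds of the individual leader
      decisions into one.\<close>
    have V_lim: "\<forall>\<^sub>F k in sequentially. \<forall>x\<in>X. \<forall>yb\<in>?V k x. dist yb (ys x) < \<eta>" if "0 < \<eta>" for \<eta>
      using f YT(1) ys that unfolding Qf_def
      by (intro eventually_ball_finite[OF X] ballI
          robust_follower_convergence[OF S(1) \<alpha>'(2) Qstar p \<epsilon>(2) A4_lim(2)])
    have V_sub: "extended_leader_set X (?V k) T \<subseteq> D" for k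
      using M by (auto simp: extended_leader_set_def D_def robust_follower_solutions_def is_arg_max_def)
    \<comment> \<open>Once \<open>Qstar\<close> lies in the ambiguity set, it competes in the worst
      case itself.\<close>
    have wc_ge: "\<forall>\<^sub>F k in sequentially. \<forall>w\<in>D. ereal (\<psi> w) \<le> ?wc k w"
      using l unfolding worst_case_leader_cost_def \<psi>_def
      by eventually_elim (auto intro: SUP_upper)
    have wc_le: "\<forall>\<^sub>F k in sequentially. \<forall>w\<in>D. ?wc k w \<le> ereal (\<psi> w + \<eta>)" if "0 < \<eta>" for \<eta>
      using l ambiguity_set_deviation_tendsto[OF S(1) \<alpha>'(1) p \<epsilon>(1) A4_lim(1) that, where \<omega> = \<omega> and M = M]
    proof eventually_elim
      case (elim k)
      show ?case
      proof
        fix w :: "('m, 'n) leader_var" assume "w \<in> D"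
        then show "?wc k w \<le> ereal (\<psi> w + \<eta>)"
          using elim unfolding \<psi>_def
          by (intro worst_case_leader_cost_le[OF S(1) \<alpha>'(1), where M = M]) (auto simp: D_def Ql_def)
      qed
    qed
    have "closed T" by (simp add: T)
    note conv = bilevel_convergence[where X = X and T = T and V = ?V and D = D and wc = ?wc and \<psi> = \<psi> and ys = ys and C = C]
    note prems = X \<open>closed T\<close> V_ne V_lim V_sub wc_ge wc_le C
    show "limsup (\<lambda>kf. limsup (\<lambda>kl. zhat \<omega> kl kf)) = zstar"
      unfolding zhat_def Xhat_def zstar_def Xstar \<psi>_def[symmetric] by (rule conv(1)) (fact prems)+
    show "is_arg_min \<psi> (\<lambda>xbar. xbar \<in> Xstar) z"
      if "\<And>kl kf. 1 \<le> kf \<Longrightarrow> kf \<le> kl \<Longrightarrow>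
          is_arg_min (worst_case_leader_cost \<alpha>l (Ql \<omega> kl)) (\<lambda>xbar. xbar \<in> Xhat \<omega> kf) (u kl kf)"
        "accumulation_point u z" for u z
      unfolding Xstar by (rule conv(2)[where u = u]) (fact prems that[unfolded Xhat_def])+
  qed

  have "AE \<omega> in Qinf. limsup (\<lambda>kf. limsup (\<lambda>kl. zhat \<omega> kl kf)) = zstar"
    using AE_l AE_f by eventually_elim (rule conv(1))
  moreover have "zstar = SI_value \<alpha>l \<alpha>f X Y Qstar"
    unfolding zstar_def Xstar by (rule SI_value_eq[where S = S and a = a and b = b]) (fact S Qstar \<alpha>' T in_T ys)+
  moreover have "AE \<omega> in Qinf. \<forall>z. accumulation_point (xs \<omega>) z \<longrightarrow>
      is_arg_min (\<lambda>xbar. \<integral>c. h\<^sub>l \<alpha>l xbar c \<partial>Qstar) (\<lambda>xbar. xbar \<in> Xstar) z"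
    if "\<forall>kl kf. 1 \<le> kf \<longrightarrow> kf \<le> kl \<longrightarrow>
      (AE \<omega> in Qinf. is_arg_min (worst_case_leader_cost \<alpha>l (Ql \<omega> kl)) (\<lambda>xbar. xbar \<in> Xhat \<omega> kf) (xs \<omega> kl kf))"
    for xs :: "(nat \<Rightarrow> real^'n) \<Rightarrow> nat \<Rightarrow> nat \<Rightarrow> ('m, 'n) leader_var"
  proof -
    \<comment> \<open>There are countably many pairs of sample sizes, so the null sets on which
      optimality may fail can be united into one.\<close>
    have "AE \<omega> in Qinf. \<forall>kl kf. 1 \<le> kf \<longrightarrow> kf \<le> kl \<longrightarrow>
        is_arg_min (worst_case_leader_cost \<alpha>l (Ql \<omega> kl)) (\<lambda>xbar. xbar \<in> Xhat \<omega> kf) (xs \<omega> kl kf)"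
      using that by (simp add: AE_all_countable)
    then show ?thesis
      using AE_l AE_f
    proof eventually_elim
      case (elim \<omega>)
      then show ?case
        using conv(2)[OF elim(2,3), of "xs \<omega>"] unfolding \<psi>_def by blast
    qed
  qed
  ultimately show ?thesis by blast
qed

end
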